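(* Let $\mathbb X=(X,\{e_i\},\{\gamma_i\},E_{\mathbb X})$ and $\mathbb Y=(Y,\{e_i\},\{\gamma_i\},E_{\mathbb Y})$ be $\varepsilon$-geometric crystals of type $A_n$ with epsilon systems $E_{\mathbb X},E_{\mathbb Y}$, such that the functions $\varepsilon_i,\gamma_i$ ($i\in I$) on $X$ and on $Y$ are not identically zero (on any component). Suppose that there exists a tropical R map $\mathcal R:X\times Y\to Y\times X$. Let $\{\varepsilon^{\mathbb X\times\mathbb Y}_J,\varepsilon^{*\,\mathbb X\times\mathbb Y}_J\}_{J\in\mathcal J}$ and $\{\varepsilon^{\mathbb Y\times\mathbb X}_J,\varepsilon^{*\,\mathbb Y\times\mathbb X}_J\}_{J\in\mathcal J}$ be the product epsilon systems on $\mathbb X\times \mathbb Y$ and $\mathbb Y\times\mathbb X$ obtained from $E_{\mathbb X}$ and $E_{\mathbb Y}$. Then for every $J\in\mathcal J$, $$\varepsilon^{\mathbb Y\times\mathbb X}_J(\mathcal R(x,y))=\varepsilon^{\mathbb X\times\mathbb Y}_J(x,y),\qquad \varepsilon^{*\,\mathbb Y\times\mathbb X}_J(\mathcal R(x,y))=\varepsilon^{*\,\mathbb X\times\mathbb Y}_J(x,y)$$ as rational functions on $X\times Y$.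
   Context: Let $n\ge1$, $I=\{1,\dots,n\}$, and let $(a_{ij})_{i,j\in I}$ be the Cartan matrix of type $A_n$ ($a_{ii}=2$, $a_{ij}=-1$ if $|i-j|=1$, $a_{ij}=0$ otherwise). Identities between rational maps or rational functions mean equality on a dense open subset. A geometric crystal of type $A_n$ is a quadruple $(X,\{e_i\}_{i\in I},\{\gamma_i\}_{i\in I},\{\varepsilon_i\}_{i\in I})$ with $X$ an ind-variety over $\mathbb C$, $\gamma_i,\varepsilon_i$ rational functions on $X$, and $e_i:\mathbb C^\times\times X\to X$, $(c,x)\mapsto e_i^c(x)$, rational $\mathbb C^\times$-actions such that: (i) $(\{1\}\times X)\cap \mathrm{dom}(e_i)$ is open dense in $\{1\}\times X$; (ii) $\gamma_j(e_i^c(x))=c^{a_{ij}}\gamma_j(x)$; (iii) $e_i^{c_1}e_j^{c_2}=e_j^{c_2}e_i^{c_1}$ if $a_{ij}=0$, and $e_i^{c_1}e_j^{c_1c_2}e_i^{c_2}=e_j^{c_2}e_i^{c_1c_2}e_j^{c_1}$ if $a_{ij}=-1$; (iv) $\varepsilon_i(e_i^c(x))=c^{-1}\varepsilon_i(x)$, and $\varepsilon_i(e_j^c(x))=\varepsilon_i(x)$ if $a_{ij}=0$. Intervals: $[s,t]=\{s,s+1,\dots,t\}$ for $s\le t$, and $[s,t]=\varnothing$ if $s>t$. $\mathcal J$ is the set of (nonempty) intervals contained in $I$. A partition of an interval $J$ is a set $P=\{I_1,\dots,I_k\}$ of disjoint (nonempty) intervals with $I_1\sqcup\cdots\sqcup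 I_k=J$ and $\max(I_j)<\min(I_{j+1})$; $l(P)=k$; $\mathcal P_J$ is the set of partitions of $J$. Put $\varepsilon_P:=\varepsilon_{I_1}\cdots\varepsilon_{I_k}$. An epsilon system of such a geometric crystal is a set of rational functions $\{\varepsilon_J,\varepsilon^*_J\mid J\in\mathcal J\}$ on $X$ with $\varepsilon_{\{i\}}=\varepsilon_i$ (the given function) such that, for every $J=[s,t]\in\mathcal J$ and $i\in I$: (a) $\varepsilon_J(e_i^cx)=c^{-1}\varepsilon_J(x)$ if $i=s$, and $\varepsilon_J(e_i^cx)=\varepsilon_J(x)$ if $i\ne s-1,s,t+1$; (b) $\varepsilon^*_J(e_i^cx)=c^{-1}\varepsilon^*_J(x)$ if $i=t$, and $\varepsilon^*_J(e_i^cx)=\varepsilon^*_J(x)$ if $i\neq s-1,t,t+1$; (c) $\varepsilon^*_J=\sum_{P\in\mathcal P_J}(-1)^{|J|-l(P)}\varepsilon_P$. Convention: $\varepsilon_\varnothing=\varepsilon^*_\varnothing=1$. A geometric crystal with an epsilon system is called an $\varepsilon$-geometric crystal. Product structure on $X\times Y$: $\gamma_i(x,y)=\gamma^X_i(x)\gamma^Y_i(y)$, $\varepsilon_i(x,y)=\varepsilon^X_i(x)+\varepsilon^Y_i(y)/\gamma^X_i(x)$, and $e_i^c(x,y)=(e_i^{c_1}(x),e_i^{c_2}(y))$ with $c_1=\frac{c\,\gamma^X_i(x)\varepsilon^X_i(x)+\varepsilon^Y_i(y)}{\gamma^X_i(x)\varepsilon^X_i(x)+\varepsilon^Y_i(y)}$,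 $c_2=c/c_1$. Products are said to have a geometric crystal structure if these formulas are well defined and give a geometric crystal. Product epsilon system: for $\varepsilon$-geometric crystals $\mathbb X,\mathbb Y$ whose product has a geometric crystal structure, the functions $$\varepsilon^{\mathbb X\times\mathbb Y}_{[s,t]}(x,y)=\sum_{k=s-1}^{t}\frac{\varepsilon^Y_{[s,k]}(y)\,\varepsilon^X_{[k+1,t]}(x)}{\prod_{j=s}^{k}\gamma^X_j(x)},\qquad \varepsilon^{*\,\mathbb X\times\mathbb Y}_{[s,t]}(x,y)=\sum_{k=s-1}^{t}\frac{\varepsilon^{*X}_{[s,k]}(x)\,\varepsilon^{*Y}_{[k+1,t]}(y)}{\prod_{j=k+1}^{t}\gamma^X_j(x)}$$ form an epsilon system on $\mathbb X\times\mathbb Y$ (and symmetrically for $\mathbb Y\times\mathbb X$). Tropical R map: let $\{X_\lambda\}_{\lambda\in\Lambda}$ be a family of geometric crystals whose products have geometric crystal structures. Birational maps $\mathcal R_{\lambda\mu}:X_\lambda\times X_\mu\to X_\mu\times X_\lambda$ are called tropical R maps if for all $i\in I$ and $\lambda,\mu,\nu\in\Lambda$: $e_i^c\circ\mathcal R_{\lambda\mu}=\mathcal R_{\lambda\mu}\circ e_i^c$; $\varepsilon_i^{X_\lambda\times X_\mu}=\varepsilon_i^{X_\mu\times X_\lambda}\circ\mathcal R_{\lambda\mu}$; $\gamma_i^{X_\lambda\times X_\mu}=\gamma_i^{X_\mu\times X_\lambda}\circ\mathcal R_{\lambda\mu}$; and the Yang–Baxter equation $(\mathcal R_{\mu\nu}\times\mathrm{id})(\mathrm{id}\times\mathcal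 R_{\lambda\nu})(\mathcal R_{\lambda\mu}\times\mathrm{id})=(\mathrm{id}\times\mathcal R_{\lambda\mu})(\mathcal R_{\lambda\nu}\times\mathrm{id})(\mathrm{id}\times\mathcal R_{\mu\nu})$ holds on $X_\lambda\times X_\mu\times X_\nu$. In the claim, $\mathcal R=\mathcal R_{\lambda\mu}$ for some such family with $X=X_\lambda$, $Y=X_\mu$. *)

theory Defs
  imports
    "HOL-Analysis.Analysis"
    "HOL-Computational_Algebra.Polynomial"
    "HOL-Library.Disjoint_Sets"
    "HOL-Library.Monad_Syntax"
begin

section \<open>Varieties over the complex numbers\<close>

text \<open>
  Varieties are spaces with functions: a topological space with a sheaf of complex-valued
  functions which is locally isomorphic to a closed subset of affine space with its regular
  functions.  They are not required to be irreducible.  Functions are total in HOL; an element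
  of \<open>reg S U\<close> only matters through its values on \<open>U\<close>.
\<close>

record 'a fspace =
  zar :: "'a topology"
  reg :: "'a set \<Rightarrow> ('a \<Rightarrow> complex) set"

abbreviation points :: "'a fspace \<Rightarrow> 'a set" where
  "points S \<equiv> topspace (zar S)"

text \<open>The last condition of the locality axiom does not ask for \<open>V \<subseteq> U\<close>, so the axiom covers
  restriction to smaller open sets as well as gluing.\<close>

definition space_with_functions :: "'a fspace \<Rightarrow> bool" where
  "space_with_functions S \<longleftrightarrow>
     (\<forall>U f. f \<in> reg S U \<longleftrightarrow>
        openin (zar S) U \<and>
        (\<forall>x\<in>U. \<exists>V g. openin (zar S) V \<and> x \<in> V \<and> g \<in> reg S V \<and> (\<forall>y\<in>U \<inter> V. f y = g y))) \<and>
     (\<forall>U. openin (zar S) U \<longrightarrow>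
        (\<forall>a. (\<lambda>_. a) \<in> reg S U) \<and>
        (\<forall>f\<in>reg S U. \<forall>g\<in>reg S U. (\<lambda>x. f x + g x) \<in> reg S U \<and> (\<lambda>x. f x * g x) \<in> reg S U) \<and>
        (\<forall>f\<in>reg S U. openin (zar S) {x\<in>U. f x \<noteq> 0} \<and>
                      (\<lambda>x. inverse (f x)) \<in> reg S {x\<in>U. f x \<noteq> 0}))"

text \<open>The space with functions whose basic open sets are the non-vanishing loci of given functions
  \<open>h\<close> on given sets \<open>A\<close>, and whose regular functions are locally quotients of given functions.\<close>

definition fspace_of :: "('a set \<times> ('a \<Rightarrow> complex)) set \<Rightarrow> 'a fspace" where
  "fspace_of G =
     (let T = topology_generated_by {{x\<in>A. h x \<noteq> 0} | A h. (A, h) \<in> G} in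
      \<lparr>zar = T,
       reg = (\<lambda>U. {f. openin T U \<and>
          (\<forall>x\<in>U. \<exists>A h k. (A, h) \<in> G \<and> (A, k) \<in> G \<and> x \<in> A \<and> k x \<noteq> 0 \<and>
             (\<forall>y\<in>U \<inter> A. k y \<noteq> 0 \<longrightarrow> f y = h y / k y))})\<rparr>)"

text \<open>Polynomial functions in the coordinates \<open>x 0, \<dots>, x (n - 1)\<close>.\<close>

inductive_set poly_functions :: "nat \<Rightarrow> ((nat \<Rightarrow> complex) \<Rightarrow> complex) set" for n where
  const: "(\<lambda>_. a) \<in> poly_functions n"
| coord: "i < n \<Longrightarrow> (\<lambda>x. x i) \<in> poly_functions n"
| add: "p \<in> poly_functions n \<Longrightarrow> q \<in> poly_functions n \<Longrightarrow> (\<lambda>x. p x + q x) \<in> poly_functions n"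
| mult: "p \<in> poly_functions n \<Longrightarrow> q \<in> poly_functions n \<Longrightarrow> (\<lambda>x. p x * q x) \<in> poly_functions n"

definition affine_nspace :: "nat \<Rightarrow> (nat \<Rightarrow> complex) fspace" where
  "affine_nspace n = fspace_of {({x. \<forall>i\<ge>n. x i = 0}, p) | p. p \<in> poly_functions n}"

text \<open>The multiplicative group \<open>\<complex>\<^sup>\<times>\<close>; quotients of polynomials include the
  Laurent polynomials.\<close>

definition Gm :: "complex fspace" where
  "Gm = fspace_of {(- {0}, poly p) | p. True}"

text \<open>Induced (reduced) structure on a subset: functions that locally extend to regular
  functions.\<close>

definition fs_restrict :: "'a fspace \<Rightarrow> 'a set \<Rightarrow> 'a fspace" where
  "fs_restrict S A =
     \<lparr>zar = subtopology (zar S) A,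
      reg = (\<lambda>U. {f. openin (subtopology (zar S) A) U \<and>
         (\<forall>x\<in>U. \<exists>V g. openin (zar S) V \<and> x \<in> V \<and> g \<in> reg S V \<and> (\<forall>y\<in>U \<inter> V. f y = g y))})\<rparr>"

text \<open>The product in the category of varieties; its topology is finer than the product topology.\<close>

definition fs_prod :: "'a fspace \<Rightarrow> 'b fspace \<Rightarrow> ('a \<times> 'b) fspace" where
  "fs_prod S T = fspace_of
     {(A \<times> B, h) | A B h. openin (zar S) A \<and> openin (zar T) B \<and>
        (\<exists>(m::nat) f g. (\<forall>i<m. f i \<in> reg S A \<and> g i \<in> reg T B) \<and>
           h = (\<lambda>(x, y). \<Sum>i<m. f i x * g i y))}"

definition fs_morphism :: "'a fspace \<Rightarrow> 'b fspace \<Rightarrow> ('a \<Rightarrow> 'b) \<Rightarrow> bool" where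
  "fs_morphism S T f \<longleftrightarrow>
     continuous_map (zar S) (zar T) f \<and>
     (\<forall>V. \<forall>g\<in>reg T V. g \<circ> f \<in> reg S {x\<in>points S. f x \<in> V})"

definition fs_isomorphic :: "'a fspace \<Rightarrow> 'b fspace \<Rightarrow> bool" where
  "fs_isomorphic S T \<longleftrightarrow>
     (\<exists>f g. fs_morphism S T f \<and> fs_morphism T S g \<and>
        (\<forall>x\<in>points S. g (f x) = x) \<and> (\<forall>y\<in>points T. f (g y) = y))"

definition affine_variety :: "'a fspace \<Rightarrow> bool" where
  "affine_variety S \<longleftrightarrow>
     (\<exists>n Z. closedin (zar (affine_nspace n)) Z \<and>
        fs_isomorphic S (fs_restrict (affine_nspace n) Z))"

definition variety :: "'a fspace \<Rightarrow> bool" where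
  "variety S \<longleftrightarrow>
     space_with_functions S \<and>
     (\<exists>\<U>. finite \<U> \<and> \<Union>\<U> = points S \<and>
        (\<forall>U\<in>\<U>. openin (zar S) U \<and> affine_variety (fs_restrict S U))) \<and>
     closedin (zar (fs_prod S S)) {(x, x) | x. x \<in> points S}"

section \<open>Ind-varieties, rational functions and rational maps\<close>

text \<open>An ind-variety is given by its filtration; the closed embeddings are taken to be inclusions.\<close>

type_synonym 'a ind = "nat \<Rightarrow> 'a fspace"

definition ind_variety :: "'a ind \<Rightarrow> bool" where
  "ind_variety X \<longleftrightarrow>
     (\<forall>k. variety (X k) \<and> closedin (zar (X (Suc k))) (points (X k)) \<and>
          X k = fs_restrict (X (Suc k)) (points (X k)))"

definition ind_points :: "'a ind \<Rightarrow> 'a set" where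
  "ind_points X = (\<Union>k. points (X k))"

definition ind_top :: "'a ind \<Rightarrow> 'a topology" where
  "ind_top X = topology (\<lambda>U. U \<subseteq> ind_points X \<and> (\<forall>k. openin (zar (X k)) (U \<inter> points (X k))))"

lemma openin_ind_top:
  "openin (ind_top X) U \<longleftrightarrow>
     U \<subseteq> ind_points X \<and> (\<forall>k. openin (zar (X k)) (U \<inter> points (X k)))"
proof -
  let ?P = "\<lambda>U. U \<subseteq> ind_points X \<and> (\<forall>k. openin (zar (X k)) (U \<inter> points (X k)))"
  have "istopology ?P"
    unfolding istopology_def
  proof (intro conjI allI impI)
    fix S T assume S: "?P S" and T: "?P T"
    show "S \<inter> T \<subseteq> ind_points X" using S by blast
    fix k
    have "openin (zar (X k)) ((S \<inter> points (X k)) \<inter> (T \<inter> points (X k)))"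
      using S T openin_Int by blast
    moreover have "(S \<inter> points (X k)) \<inter> (T \<inter> points (X k)) = S \<inter> T \<inter> points (X k)" by blast
    ultimately show "openin (zar (X k)) (S \<inter> T \<inter> points (X k))" by simp
  next
    fix K assume K: "\<forall>U\<in>K. ?P U"
    show "\<Union>K \<subseteq> ind_points X" using K by blast
    fix k
    have "openin (zar (X k)) (\<Union>U\<in>K. U \<inter> points (X k))"
      using K by (intro openin_Union) blast
    moreover have "(\<Union>U\<in>K. U \<inter> points (X k)) = \<Union>K \<inter> points (X k)" by blast
    ultimately show "openin (zar (X k)) (\<Union>K \<inter> points (X k))" by simp
  qed
  then show ?thesis unfolding ind_top_def by simp
qed

definition ind_reg :: "'a ind \<Rightarrow> 'a set \<Rightarrow> ('a \<Rightarrow> complex) set" where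
  "ind_reg X U =
     {f. openin (ind_top X) U \<and> (\<forall>k. f \<in> reg (X k) (U \<inter> points (X k)))}"

definition ind_prod :: "'a ind \<Rightarrow> 'b ind \<Rightarrow> ('a \<times> 'b) ind"  (infixr \<open>\<times>\<^sub>I\<close> 80) where
  "X \<times>\<^sub>I Y = (\<lambda>k. fs_prod (X k) (Y k))"

abbreviation Gm_ind :: "complex ind" where
  "Gm_ind \<equiv> (\<lambda>_. Gm)"

text \<open>Morphism from the open subset \<open>U\<close> of \<open>X\<close> to \<open>Y\<close>.\<close>

definition ind_morphism_on :: "'a ind \<Rightarrow> 'a set \<Rightarrow> 'b ind \<Rightarrow> ('a \<Rightarrow> 'b) \<Rightarrow> bool" where
  "ind_morphism_on X U Y f \<longleftrightarrow>
     (\<forall>k. \<exists>m. fs_morphism (fs_restrict (X k) (U \<inter> points (X k))) (Y m) f)"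

definition dense_open :: "'a ind \<Rightarrow> 'a set \<Rightarrow> bool" where
  "dense_open X U \<longleftrightarrow> openin (ind_top X) U \<and> ind_top X closure_of U = ind_points X"

text \<open>
  Rational functions and rational maps are represented by partial functions that are regular on
  their (dense open) domain.  Two representatives need not be equal, only \<open>rat_eq\<close>.
  Since the common open set must lie in both domains, an identity involving composites
  includes the claim that these composites are generically defined.
\<close>

definition rational_function :: "'a ind \<Rightarrow> ('a \<rightharpoonup> complex) \<Rightarrow> bool" where
  "rational_function X f \<longleftrightarrow> dense_open X (dom f) \<and> (\<lambda>x. the (f x)) \<in> ind_reg X (dom f)"

definition rational_map :: "'a ind \<Rightarrow> 'b ind \<Rightarrow> ('a \<rightharpoonup> 'b) \<Rightarrow> bool" where
  "rational_map X Y f \<longleftrightarrow>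
     dense_open X (dom f) \<and> ind_morphism_on X (dom f) Y (\<lambda>x. the (f x))"

definition rat_eq :: "'a ind \<Rightarrow> ('a \<rightharpoonup> 'b) \<Rightarrow> ('a \<rightharpoonup> 'b) \<Rightarrow> bool" where
  "rat_eq X f g \<longleftrightarrow>
     (\<exists>W. dense_open X W \<and> W \<subseteq> dom f \<and> W \<subseteq> dom g \<and> (\<forall>x\<in>W. f x = g x))"

text \<open>The domain of definition of a rational map: all points where some representative is
  defined.\<close>

definition rat_domain :: "'a ind \<Rightarrow> 'b ind \<Rightarrow> ('a \<rightharpoonup> 'b) \<Rightarrow> 'a set" where
  "rat_domain X Y f = (\<Union>g\<in>{g. rational_map X Y g \<and> rat_eq X f g}. dom g)"

definition birational_map :: "'a ind \<Rightarrow> 'b ind \<Rightarrow> ('a \<rightharpoonup> 'b) \<Rightarrow> bool" where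
  "birational_map X Y f \<longleftrightarrow>
     rational_map X Y f \<and>
     (\<exists>g. rational_map Y X g \<and> rat_eq X (g \<circ>\<^sub>m f) Some \<and> rat_eq Y (f \<circ>\<^sub>m g) Some)"

definition irreducible_in :: "'a topology \<Rightarrow> 'a set \<Rightarrow> bool" where
  "irreducible_in T C \<longleftrightarrow>
     C \<subseteq> topspace T \<and> C \<noteq> {} \<and>
     (\<forall>U V. openin T U \<and> openin T V \<and> U \<inter> C \<noteq> {} \<and> V \<inter> C \<noteq> {} \<longrightarrow> U \<inter> V \<inter> C \<noteq> {})"

definition irreducible_component_of :: "'a topology \<Rightarrow> 'a set \<Rightarrow> bool" where
  "irreducible_component_of T C \<longleftrightarrow>
     irreducible_in T C \<and> (\<forall>D. irreducible_in T D \<and> C \<subseteq> D \<longrightarrow> D = C)"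

definition nonzero_on_components :: "'a ind \<Rightarrow> ('a \<rightharpoonup> complex) \<Rightarrow> bool" where
  "nonzero_on_components X f \<longleftrightarrow>
     (\<forall>C. irreducible_component_of (ind_top X) C \<longrightarrow> \<not> (\<forall>x\<in>C \<inter> dom f. f x = Some 0))"

text \<open>A rational action of \<open>\<complex>\<^sup>\<times>\<close>.  The unit law is imposed on a representative
  that is defined on a dense open subset of \<open>{1} \<times> X\<close>.\<close>

definition rational_Gm_action :: "'a ind \<Rightarrow> (complex \<Rightarrow> 'a \<rightharpoonup> 'a) \<Rightarrow> bool" where
  "rational_Gm_action X e \<longleftrightarrow>
     rational_map (Gm_ind \<times>\<^sub>I X) X (\<lambda>(c, x). e c x) \<and>
     rat_eq (Gm_ind \<times>\<^sub>I Gm_ind \<times>\<^sub>I X)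
       (\<lambda>(c\<^sub>1, c\<^sub>2, x). (e c\<^sub>1 \<circ>\<^sub>m e c\<^sub>2) x) (\<lambda>(c\<^sub>1, c\<^sub>2, x). e (c\<^sub>1 * c\<^sub>2) x) \<and>
     (\<exists>g. rational_map (Gm_ind \<times>\<^sub>I X) X g \<and> rat_eq (Gm_ind \<times>\<^sub>I X) (\<lambda>(c, x). e c x) g \<and>
          rat_eq X (\<lambda>x. g (1, x)) Some)"

text \<open>Arithmetic of partial functions; quotients are undefined where the denominator vanishes.\<close>

definition odiv :: "complex \<Rightarrow> complex \<Rightarrow> complex option" where
  "odiv a b = (if b = 0 then None else Some (a / b))"

definition psum :: "('i \<Rightarrow> 'a \<rightharpoonup> complex) \<Rightarrow> 'i set \<Rightarrow> 'a \<rightharpoonup> complex" where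
  "psum F A x = (if \<forall>k\<in>A. x \<in> dom (F k) then Some (\<Sum>k\<in>A. the (F k x)) else None)"

definition pprod :: "('i \<Rightarrow> 'a \<rightharpoonup> complex) \<Rightarrow> 'i set \<Rightarrow> 'a \<rightharpoonup> complex" where
  "pprod F A x = (if \<forall>k\<in>A. x \<in> dom (F k) then Some (\<Prod>k\<in>A. the (F k x)) else None)"

section \<open>Geometric crystals of type \<open>A\<^sub>n\<close>\<close>

definition cartan :: "nat \<Rightarrow> nat \<Rightarrow> int" where
  "cartan i j = (if i = j then 2 else if i = j + 1 \<or> j = i + 1 then - 1 else 0)"

record 'a crystal =
  pts :: "'a ind"
  act :: "nat \<Rightarrow> complex \<Rightarrow> 'a \<rightharpoonup> 'a"
  gam :: "nat \<Rightarrow> 'a \<rightharpoonup> complex"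
  epsi :: "nat \<Rightarrow> 'a \<rightharpoonup> complex"

definition geometric_crystal :: "nat \<Rightarrow> 'a crystal \<Rightarrow> bool" where
  "geometric_crystal n X \<longleftrightarrow>
     ind_variety (pts X) \<and>
     (\<forall>i\<in>{1..n}. rational_function (pts X) (gam X i) \<and> rational_function (pts X) (epsi X i) \<and>
        rational_Gm_action (pts X) (act X i)) \<and>
     (\<forall>i\<in>{1..n}. dense_open (pts X)
        {x. (1, x) \<in> rat_domain (Gm_ind \<times>\<^sub>I pts X) (pts X) (\<lambda>(c, x). act X i c x)}) \<and>
     (\<forall>i\<in>{1..n}. \<forall>j\<in>{1..n}. rat_eq (Gm_ind \<times>\<^sub>I pts X)
        (\<lambda>(c, x). (gam X j \<circ>\<^sub>m act X i c) x)
        (\<lambda>(c, x). map_option (\<lambda>v. c powi cartan i j * v) (gam X j x))) \<and>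
     (\<forall>i\<in>{1..n}. \<forall>j\<in>{1..n}. cartan i j = 0 \<longrightarrow>
        rat_eq (Gm_ind \<times>\<^sub>I Gm_ind \<times>\<^sub>I pts X)
          (\<lambda>(c\<^sub>1, c\<^sub>2, x). (act X i c\<^sub>1 \<circ>\<^sub>m act X j c\<^sub>2) x)
          (\<lambda>(c\<^sub>1, c\<^sub>2, x). (act X j c\<^sub>2 \<circ>\<^sub>m act X i c\<^sub>1) x)) \<and>
     (\<forall>i\<in>{1..n}. \<forall>j\<in>{1..n}. cartan i j = - 1 \<longrightarrow>
        rat_eq (Gm_ind \<times>\<^sub>I Gm_ind \<times>\<^sub>I pts X)
          (\<lambda>(c\<^sub>1, c\<^sub>2, x). (act X i c\<^sub>1 \<circ>\<^sub>m act X j (c\<^sub>1 * c\<^sub>2) \<circ>\<^sub>m act X i c\<^sub>2) x)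
          (\<lambda>(c\<^sub>1, c\<^sub>2, x). (act X j c\<^sub>2 \<circ>\<^sub>m act X i (c\<^sub>1 * c\<^sub>2) \<circ>\<^sub>m act X j c\<^sub>1) x)) \<and>
     (\<forall>i\<in>{1..n}. rat_eq (Gm_ind \<times>\<^sub>I pts X)
        (\<lambda>(c, x). (epsi X i \<circ>\<^sub>m act X i c) x)
        (\<lambda>(c, x). map_option (\<lambda>v. inverse c * v) (epsi X i x))) \<and>
     (\<forall>i\<in>{1..n}. \<forall>j\<in>{1..n}. cartan i j = 0 \<longrightarrow>
        rat_eq (Gm_ind \<times>\<^sub>I pts X)
          (\<lambda>(c, x). (epsi X i \<circ>\<^sub>m act X j c) x)
          (\<lambda>(c, x). epsi X i x))"

text \<open>The product structure.  The action is automatically undefined where \<open>c\<^sub>1 = 0\<close>,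
  because the domains of the two actions only contain parameters in \<open>\<complex>\<^sup>\<times>\<close>.\<close>

definition crystal_prod :: "'a crystal \<Rightarrow> 'b crystal \<Rightarrow> ('a \<times> 'b) crystal" where
  "crystal_prod X Y =
     \<lparr>pts = pts X \<times>\<^sub>I pts Y,
      act = (\<lambda>i c (x, y).
        do { g \<leftarrow> gam X i x;
             a \<leftarrow> epsi X i x;
             b \<leftarrow> epsi Y i y;
             c\<^sub>1 \<leftarrow> odiv (c * g * a + b) (g * a + b);
             c\<^sub>2 \<leftarrow> odiv c c\<^sub>1;
             x' \<leftarrow> act X i c\<^sub>1 x;
             y' \<leftarrow> act Y i c\<^sub>2 y;
             Some (x', y') }),
      gam = (\<lambda>i (x, y). do { g \<leftarrow> gam X i x; h \<leftarrow> gam Y i y; Some (g * h) }),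
      epsi = (\<lambda>i (x, y).
        do { a \<leftarrow> epsi X i x;
             b \<leftarrow> epsi Y i y;
             g \<leftarrow> gam X i x;
             q \<leftarrow> odiv b g;
             Some (a + q) })\<rparr>"

section \<open>Epsilon systems\<close>

definition intervals :: "nat \<Rightarrow> nat set set" where
  "intervals n = {{s..t} | s t. 1 \<le> s \<and> s \<le> t \<and> t \<le> n}"

definition interval_partitions :: "nat set \<Rightarrow> nat set set set" where
  "interval_partitions J = {P. partition_on J P \<and> (\<forall>K\<in>P. \<exists>a b. K = {a..b})}"

text \<open>Both families are indexed by the nonempty intervals; other index values are irrelevant.\<close>

record 'a eps_system =
  eps :: "nat set \<Rightarrow> 'a \<rightharpoonup> complex"
  eps_star :: "nat set \<Rightarrow> 'a \<rightharpoonup> complex"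

definition epsilon_system :: "nat \<Rightarrow> 'a crystal \<Rightarrow> 'a eps_system \<Rightarrow> bool" where
  "epsilon_system n X E \<longleftrightarrow>
     (\<forall>J\<in>intervals n. rational_function (pts X) (eps E J) \<and>
        rational_function (pts X) (eps_star E J)) \<and>
     (\<forall>i\<in>{1..n}. rat_eq (pts X) (eps E {i}) (epsi X i)) \<and>
     (\<forall>s t i. 1 \<le> s \<and> s \<le> t \<and> t \<le> n \<and> i \<in> {1..n} \<longrightarrow>
        (i = s \<longrightarrow> rat_eq (Gm_ind \<times>\<^sub>I pts X)
           (\<lambda>(c, x). (eps E {s..t} \<circ>\<^sub>m act X i c) x)
           (\<lambda>(c, x). map_option (\<lambda>v. inverse c * v) (eps E {s..t} x))) \<and>
        (i \<notin> {s - 1, s, t + 1} \<longrightarrow> rat_eq (Gm_ind \<times>\<^sub>I pts X)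
           (\<lambda>(c, x). (eps E {s..t} \<circ>\<^sub>m act X i c) x)
           (\<lambda>(c, x). eps E {s..t} x)) \<and>
        (i = t \<longrightarrow> rat_eq (Gm_ind \<times>\<^sub>I pts X)
           (\<lambda>(c, x). (eps_star E {s..t} \<circ>\<^sub>m act X i c) x)
           (\<lambda>(c, x). map_option (\<lambda>v. inverse c * v) (eps_star E {s..t} x))) \<and>
        (i \<notin> {s - 1, t, t + 1} \<longrightarrow> rat_eq (Gm_ind \<times>\<^sub>I pts X)
           (\<lambda>(c, x). (eps_star E {s..t} \<circ>\<^sub>m act X i c) x)
           (\<lambda>(c, x). eps_star E {s..t} x))) \<and>
     (\<forall>J\<in>intervals n. rat_eq (pts X) (eps_star E J)
        (psum (\<lambda>P x. map_option (\<lambda>v. (- 1) ^ (card J - card P) * v) (pprod (eps E) P x))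
           (interval_partitions J)))"

text \<open>The convention \<open>\<epsilon>\<^sub>\<emptyset> = \<epsilon>\<^sup>*\<^sub>\<emptyset> = 1\<close>.\<close>

definition with_empty :: "(nat set \<Rightarrow> 'a \<rightharpoonup> complex) \<Rightarrow> nat set \<Rightarrow> 'a \<rightharpoonup> complex" where
  "with_empty F J = (if J = {} then (\<lambda>_. Some 1) else F J)"

text \<open>The product epsilon system, evaluated at intervals \<open>J = {s..t}\<close> with \<open>s \<ge> 1\<close>.\<close>

definition eps_system_prod ::
  "'a crystal \<Rightarrow> 'b crystal \<Rightarrow> 'a eps_system \<Rightarrow> 'b eps_system \<Rightarrow> ('a \<times> 'b) eps_system" where
  "eps_system_prod X Y E F =
     \<lparr>eps = (\<lambda>J. let s = Min J; t = Max J in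
        psum (\<lambda>k (x, y).
          do { b \<leftarrow> with_empty (eps F) {s..k} y;
               a \<leftarrow> with_empty (eps E) {k+1..t} x;
               g \<leftarrow> pprod (gam X) {s..k} x;
               odiv (b * a) g }) {s-1..t}),
      eps_star = (\<lambda>J. let s = Min J; t = Max J in
        psum (\<lambda>k (x, y).
          do { a \<leftarrow> with_empty (eps_star E) {s..k} x;
               b \<leftarrow> with_empty (eps_star F) {k+1..t} y;
               g \<leftarrow> pprod (gam X) {k+1..t} x;
               odiv (a * b) g }) {s-1..t})\<rparr>"

section \<open>Tropical R maps\<close>

definition on12 :: "('a \<times> 'b \<rightharpoonup> 'c \<times> 'd) \<Rightarrow> 'a \<times> 'b \<times> 'z \<rightharpoonup> 'c \<times> 'd \<times> 'z" where
  "on12 R = (\<lambda>(x, y, z). map_option (\<lambda>(u, v). (u, v, z)) (R (x, y)))"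

definition on23 :: "('a \<times> 'b \<rightharpoonup> 'c \<times> 'd) \<Rightarrow> 'z \<times> 'a \<times> 'b \<rightharpoonup> 'z \<times> 'c \<times> 'd" where
  "on23 R = (\<lambda>(z, x, y). map_option (\<lambda>p. (z, p)) (R (x, y)))"

text \<open>The members of the family share one point type, which is no restriction:
  their underlying sets can be embedded into a common type.\<close>

definition tropical_R_maps ::
  "nat \<Rightarrow> 'l set \<Rightarrow> ('l \<Rightarrow> 'a crystal) \<Rightarrow> ('l \<Rightarrow> 'l \<Rightarrow> 'a \<times> 'a \<rightharpoonup> 'a \<times> 'a) \<Rightarrow> bool" where
  "tropical_R_maps n \<Lambda> X R \<longleftrightarrow>
     (\<forall>\<kappa>\<in>\<Lambda>. geometric_crystal n (X \<kappa>)) \<and>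
     (\<forall>\<kappa>\<in>\<Lambda>. \<forall>\<mu>\<in>\<Lambda>. geometric_crystal n (crystal_prod (X \<kappa>) (X \<mu>))) \<and>
     (\<forall>\<kappa>\<in>\<Lambda>. \<forall>\<mu>\<in>\<Lambda>.
        birational_map (pts (X \<kappa>) \<times>\<^sub>I pts (X \<mu>)) (pts (X \<mu>) \<times>\<^sub>I pts (X \<kappa>)) (R \<kappa> \<mu>)) \<and>
     (\<forall>i\<in>{1..n}. \<forall>\<kappa>\<in>\<Lambda>. \<forall>\<mu>\<in>\<Lambda>.
        rat_eq (Gm_ind \<times>\<^sub>I pts (X \<kappa>) \<times>\<^sub>I pts (X \<mu>))
          (\<lambda>(c, z). (act (crystal_prod (X \<mu>) (X \<kappa>)) i c \<circ>\<^sub>m R \<kappa> \<mu>) z)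
          (\<lambda>(c, z). (R \<kappa> \<mu> \<circ>\<^sub>m act (crystal_prod (X \<kappa>) (X \<mu>)) i c) z) \<and>
        rat_eq (pts (X \<kappa>) \<times>\<^sub>I pts (X \<mu>))
          (epsi (crystal_prod (X \<kappa>) (X \<mu>)) i)
          (epsi (crystal_prod (X \<mu>) (X \<kappa>)) i \<circ>\<^sub>m R \<kappa> \<mu>) \<and>
        rat_eq (pts (X \<kappa>) \<times>\<^sub>I pts (X \<mu>))
          (gam (crystal_prod (X \<kappa>) (X \<mu>)) i)
          (gam (crystal_prod (X \<mu>) (X \<kappa>)) i \<circ>\<^sub>m R \<kappa> \<mu>)) \<and>
     (\<forall>\<kappa>\<in>\<Lambda>. \<forall>\<mu>\<in>\<Lambda>. \<forall>\<nu>\<in>\<Lambda>.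
        rat_eq (pts (X \<kappa>) \<times>\<^sub>I pts (X \<mu>) \<times>\<^sub>I pts (X \<nu>))
          (on12 (R \<mu> \<nu>) \<circ>\<^sub>m on23 (R \<kappa> \<nu>) \<circ>\<^sub>m on12 (R \<kappa> \<mu>))
          (on23 (R \<kappa> \<mu>) \<circ>\<^sub>m on12 (R \<kappa> \<nu>) \<circ>\<^sub>m on23 (R \<mu> \<nu>)))"

end

theory Submission
  imports Defs
begin

text \<open>
  Write \<open>z = (x, y)\<close> and let \<open>D\<^sub>J(z)\<close> and \<open>D\<^sup>*\<^sub>J(z)\<close> be the differences of
  the two sides of the claimed identities for \<open>J = [s, t]\<close>.  They vanish by
  induction on the length of \<open>J\<close>.  For \<open>s = t\<close> the identity is part of the definition of a
  tropical R map.  For \<open>s < t\<close>, expanding \<open>\<epsilon>\<^sup>*\<^sub>J\<close> over partitions expresses it as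
  \<open>\<plusminus>\<epsilon>\<^sub>J\<close> plus products of functions of proper subintervals, so the induction
  hypothesis gives \<open>D\<^sup>*\<^sub>J = \<plusminus>D\<^sub>J\<close>.  Now act by \<open>e\<^sub>s\<close>, which commutes with the R map:
  it multiplies \<open>D\<^sub>J\<close> by the inverse of the parameter \<open>c\<close> and leaves \<open>D\<^sup>*\<^sub>J\<close> alone.
  Hence \<open>D\<^sub>J = D\<^sub>J / c\<close> for almost all \<open>c\<close>, and \<open>D\<^sub>J = 0\<close>.  This is carried out in
  \<open>eventually_pval_birational_eq\<close>.

  Two ingredients have to be supplied.  The algebraic one is that the product functions really
  transform in this way under \<open>e\<^sub>s\<close>, although the values of \<open>\<epsilon>\<^bsub>[s+1,t]\<^esub>\<close> and
  \<open>\<epsilon>\<^sup>*\<^bsub>[s+1,t]\<^esub>\<close> at \<open>e\<^sub>s\<^sup>c(x)\<close> are not prescribed by the axioms.  The partition formula says that the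
  triangular matrices \<open>(\<plusminus>\<epsilon>\<^bsub>[s,t]\<^esub>)\<close> and \<open>(\<epsilon>\<^sup>*\<^bsub>[s,t]\<^esub>)\<close> are inverse to each other; reading
  off the entry \<open>(s, t)\<close> of the two products before and after the action determines the missing
  values (\<open>arrays_moved_next\<close>, \<open>arrays_moved_next_star\<close>), and the
  formulas for the parameters \<open>c\<^sub>1, c\<^sub>2\<close> do the rest (\<open>prod_arrays_moved\<close>).  In the same
  language the product epsilon system is a product of triangular matrices conjugated by a
  diagonal matrix, so inverse pairs give inverse pairs (\<open>dual_arrays_prod\<close>).

  The geometric one is that all compositions are generically defined.  Everything is stated at
  generic points \<open>z\<close> and, for the actions, for all but finitely many parameters \<open>c\<close>.  The second
  condition makes sense because a nonempty Zariski open subset of \<open>\<complex>\<^sup>\<times>\<close> is cofinite, and it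
  is stable under the injective rational substitutions \<open>c \<mapsto> c\<^sub>1\<close>, \<open>c \<mapsto> c\<^sub>2\<close>.
\<close>

section \<open>The filter of dense open sets\<close>

lemma topspace_ind_top: "topspace (ind_top X) = ind_points X"
proof -
  have "openin (ind_top X) (ind_points X)"
    unfolding openin_ind_top ind_points_def
    by (metis (no_types, lifting) UNIV_I UN_upper inf.absorb_iff2 openin_topspace subset_refl)
  then show ?thesis
    by (metis openin_ind_top openin_subset openin_topspace subset_antisym)
qed

lemma dense_open_iff:
  "dense_open X W \<longleftrightarrow>
     openin (ind_top X) W \<and> (\<forall>V. openin (ind_top X) V \<and> V \<noteq> {} \<longrightarrow> W \<inter> V \<noteq> {})"
  unfolding dense_open_def topspace_ind_top[symmetric] dense_intersects_open by simp

lemma dense_open_Int: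
  assumes "dense_open X V" "dense_open X W"
  shows "dense_open X (V \<inter> W)"
  using assms unfolding dense_open_iff by (metis inf_assoc openin_Int)

text \<open>Finitely many generic conditions are imposed at once throughout, and they are pulled back along maps.
  Filters handle both: an identity of rational maps becomes an eventual identity.\<close>

definition generic :: "'a ind \<Rightarrow> 'a filter" where
  "generic X = (INF W\<in>{W. dense_open X W}. principal W)"

lemma eventually_generic:
  "eventually P (generic X) \<longleftrightarrow> (\<exists>W. dense_open X W \<and> (\<forall>x\<in>W. P x))"
proof -
  have "dense_open X (ind_points X)"
    unfolding dense_open_def
    by (metis closure_of_topspace openin_topspace topspace_ind_top)
  then show ?thesis
    unfolding generic_def
    by (subst eventually_INF_base)
       (auto simp: eventually_principal intro: dense_open_Int)
qed

lemma rat_eq_iff_generic: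
  "rat_eq X f g \<longleftrightarrow> (\<forall>\<^sub>F x in generic X. \<exists>y. f x = Some y \<and> g x = Some y)"
  unfolding rat_eq_def eventually_generic by (fastforce simp: subset_iff dom_def)

section \<open>Slices of open sets in a product\<close>

text \<open>The topology of a product of varieties is only generated by the nonvanishing sets of sums
  \<open>\<Sum> f\<^sub>i(x) g\<^sub>i(y)\<close>.  With one variable fixed, such a sum is a regular function of the other one, so
  slices of open sets are open and the projections are open maps.\<close>

lemma openin_fspace_of_induct [consumes 1, case_names Empty Int UN Basis]:
  assumes W: "openin (zar (fspace_of G)) W"
    and "P {}"
    and "\<And>U V. P U \<Longrightarrow> P V \<Longrightarrow> P (U \<inter> V)"
    and "\<And>K. (\<And>U. U \<in> K \<Longrightarrow> P U) \<Longrightarrow> P (\<Union>K)"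
    and "\<And>A h. (A, h) \<in> G \<Longrightarrow> P {x\<in>A. h x \<noteq> 0}"
  shows "P W"
proof -
  have "generate_topology_on {{x\<in>A. h x \<noteq> 0} | A h. (A, h) \<in> G} W"
    using W unfolding fspace_of_def Let_def by (simp add: openin_topology_generated_by_iff)
  then show ?thesis
  proof induction
    case Empty
    show ?case by (rule assms(2))
  next
    case (Int U V)
    then show ?case using assms(3) by blast
  next
    case (UN K)
    then show ?case using assms(4) by blast
  next
    case (Basis U)
    then show ?case using assms(5) by blast
  qed
qed

lemma openin_fspace_of_basic:
  assumes "(A, h) \<in> G"
  shows "openin (zar (fspace_of G)) {x\<in>A. h x \<noteq> 0}"
  unfolding fspace_of_def Let_def
  by (simp, rule topology_generated_by_Basis) (use assms in blast)

lemma reg_fspace_of: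
  "f \<in> reg (fspace_of G) U \<longleftrightarrow> openin (zar (fspace_of G)) U \<and>
     (\<forall>x\<in>U. \<exists>A h k. (A, h) \<in> G \<and> (A, k) \<in> G \<and> x \<in> A \<and> k x \<noteq> 0 \<and>
        (\<forall>y\<in>U \<inter> A. k y \<noteq> 0 \<longrightarrow> f y = h y / k y))"
  unfolding fspace_of_def Let_def by simp

text \<open>Boxes are basic open sets: take the constant sum \<open>1 * 1\<close>.  The hypotheses ask only for the constants
  to be regular so that the lemma also applies to \<open>\<complex>\<^sup>\<times>\<close>.\<close>

lemma openin_box_fs_prod:
  assumes "openin (zar S) A" "openin (zar T) B" "(\<lambda>_. 1) \<in> reg S A" "(\<lambda>_. 1) \<in> reg T B"
  shows "openin (zar (fs_prod S T)) (A \<times> B)"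
proof -
  let ?h = "\<lambda>(x, y). \<Sum>i<1::nat. (\<lambda>_ _. 1) i x * (\<lambda>_ _. 1::complex) i y"
  have "openin (zar (fs_prod S T)) {p \<in> A \<times> B. ?h p \<noteq> 0}"
    unfolding fs_prod_def
  proof (rule openin_fspace_of_basic)
    show "(A \<times> B, ?h) \<in> {(A \<times> B, h) | A B h. openin (zar S) A \<and> openin (zar T) B \<and>
        (\<exists>(m::nat) f g. (\<forall>i<m. f i \<in> reg S A \<and> g i \<in> reg T B) \<and>
           h = (\<lambda>(x, y). \<Sum>i<m. f i x * g i y))}"
      by (rule CollectI, rule exI[of _ A], rule exI[of _ B], rule exI[of _ ?h], intro conjI refl assms,
          rule exI[of _ 1], rule exI[of _ "\<lambda>_ _. 1"], rule exI[of _ "\<lambda>_ _. 1"])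
         (use assms in simp)
  qed
  moreover have "{p \<in> A \<times> B. ?h p \<noteq> 0} = A \<times> B" by auto
  ultimately show ?thesis by argo
qed

lemma openin_fs_prod_induct [consumes 1, case_names Empty Int UN Basis]:
  assumes "openin (zar (fs_prod S T)) W"
    and "P {}"
    and "\<And>U V. P U \<Longrightarrow> P V \<Longrightarrow> P (U \<inter> V)"
    and "\<And>K. (\<And>U. U \<in> K \<Longrightarrow> P U) \<Longrightarrow> P (\<Union>K)"
    and "\<And>A B (m::nat) f g. openin (zar S) A \<Longrightarrow> openin (zar T) B \<Longrightarrow>
           (\<And>i. i < m \<Longrightarrow> f i \<in> reg S A) \<Longrightarrow> (\<And>i. i < m \<Longrightarrow> g i \<in> reg T B) \<Longrightarrow>
           P {(x, y). x \<in> A \<and> y \<in> B \<and> (\<Sum>i<m. f i x * g i y) \<noteq> 0}"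
  shows "P W"
  using assms(1) unfolding fs_prod_def
proof (induction rule: openin_fspace_of_induct)
  case (Basis D h)
  then obtain A B f g and m :: nat where "openin (zar S) A \<and> openin (zar T) B \<and>
      (\<forall>i<m. f i \<in> reg S A \<and> g i \<in> reg T B) \<and>
      D = A \<times> B \<and> h = (\<lambda>(x, y). \<Sum>i<m. f i x * g i y)"
    unfolding mem_Collect_eq prod.inject by (elim exE conjE, intro that conjI; (simp only:)?)
  then have *: "openin (zar S) A" "openin (zar T) B"
    "\<And>i. i < m \<Longrightarrow> f i \<in> reg S A" "\<And>i. i < m \<Longrightarrow> g i \<in> reg T B"
    and D: "D = A \<times> B" "h = (\<lambda>(x, y). \<Sum>i<m. f i x * g i y)"
    by simp_all
  have "{p \<in> D. h p \<noteq> 0} = {(x, y). x \<in> A \<and> y \<in> B \<and> (\<Sum>i<m. f i x * g i y) \<noteq> 0}"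
    unfolding D by auto
  then show ?case using assms(5)[OF *] by simp
next
  case Empty
  show ?case by (rule assms(2))
next
  case (Int U V)
  then show ?case using assms(3) by blast
next
  case (UN K)
  then show ?case using assms(4) by blast
qed

lemma points_fs_prod:
  assumes "(\<lambda>_. 1) \<in> reg S (points S)" "(\<lambda>_. 1) \<in> reg T (points T)"
  shows "points (fs_prod S T) = points S \<times> points T"
proof
  have "openin (zar (fs_prod S T)) (points (fs_prod S T))" by simp
  then show "points (fs_prod S T) \<subseteq> points S \<times> points T"
    by (induction rule: openin_fs_prod_induct) (auto dest: openin_subset)
  show "points S \<times> points T \<subseteq> points (fs_prod S T)"
    using openin_box_fs_prod[OF openin_topspace openin_topspace assms] by (rule openin_subset)
qed

lemma const_reg: "space_with_functions S \<Longrightarrow> openin (zar S) U \<Longrightarrow> (\<lambda>_. a) \<in> reg S U"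
  unfolding space_with_functions_def by meson

lemma sum_reg:
  assumes "space_with_functions S" "openin (zar S) U" "\<And>i. i < m \<Longrightarrow> f i \<in> reg S U"
  shows "(\<lambda>x. \<Sum>i<(m::nat). f i x * a i) \<in> reg S U"
  using assms(3)
proof (induction m)
  case 0
  then show ?case using assms const_reg by simp
next
  case (Suc m)
  have 1: "(\<lambda>x. \<Sum>i<m. f i x * a i) \<in> reg S U" using Suc by simp
  have cl: "\<forall>f\<in>reg S U. \<forall>g\<in>reg S U. (\<lambda>x. f x + g x) \<in> reg S U \<and> (\<lambda>x. f x * g x) \<in> reg S U"
    using assms(1,2) unfolding space_with_functions_def by meson
  have 2: "(\<lambda>x. f m x * a m) \<in> reg S U"
    using cl[rule_format, OF Suc.prems[OF lessI] const_reg[OF assms(1,2)]] by simp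
  show ?case using cl[rule_format, OF 1 2] by simp
qed

lemma openin_nonvanishing:
  assumes "space_with_functions S" "f \<in> reg S U"
  shows "openin (zar S) {x\<in>U. f x \<noteq> 0}"
proof -
  have "openin (zar S) U" using assms unfolding space_with_functions_def by metis
  then show ?thesis using assms unfolding space_with_functions_def by meson
qed

lemma openin_slice_fst:
  assumes "space_with_functions S" "openin (zar (fs_prod S T)) W"
  shows "openin (zar S) {x. (x, y) \<in> W}"
  using assms(2)
proof (induction rule: openin_fs_prod_induct)
  case (Int U V)
  have "{x. (x, y) \<in> U \<inter> V} = {x. (x, y) \<in> U} \<inter> {x. (x, y) \<in> V}" by blast
  then show ?case using openin_Int[OF Int] by argo
next
  case (UN K)
  have "{x. (x, y) \<in> \<Union>K} = (\<Union>U\<in>K. {x. (x, y) \<in> U})" by blast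
  then show ?case using UN by auto
next
  case (Basis A B m f g)
  show ?case
  proof (cases "y \<in> B")
    case True
    then show ?thesis
      using openin_nonvanishing[OF assms(1) sum_reg[where S = S and U = A and m = m and f = f and a = "\<lambda>i. g i y"]] assms(1) Basis by simp
  qed simp
qed simp

lemma openin_slice_snd:
  assumes "space_with_functions T" "openin (zar (fs_prod S T)) W"
  shows "openin (zar T) {y. (x, y) \<in> W}"
  using assms(2)
proof (induction rule: openin_fs_prod_induct)
  case (Int U V)
  have "{y. (x, y) \<in> U \<inter> V} = {y. (x, y) \<in> U} \<inter> {y. (x, y) \<in> V}" by blast
  then show ?case using openin_Int[OF Int] by argo
next
  case (UN K)
  have "{y. (x, y) \<in> \<Union>K} = (\<Union>U\<in>K. {y. (x, y) \<in> U})" by blast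
  then show ?case using UN by auto
next
  case (Basis A B m f g)
  show ?case
  proof (cases "x \<in> A")
    case True
    then show ?thesis
      using openin_nonvanishing[OF assms(1) sum_reg[where S = T and U = B and m = m and f = g and a = "\<lambda>i. f i x"]] assms(1) Basis
      by (simp add: mult.commute)
  qed simp
qed simp

section \<open>The multiplicative group\<close>

lemma eventually_cofinite_poly_neq_0:
  fixes p :: "complex poly"
  assumes "p \<noteq> 0"
  shows "\<forall>\<^sub>F c in cofinite. poly p c \<noteq> 0"
  using poly_roots_finite[OF assms] by (simp add: eventually_cofinite)

text \<open>A basic open set is the nonvanishing set of a polynomial in one variable.\<close>

lemma finite_compl_openin_Gm:
  assumes "openin (zar Gm) W" "c \<in> W"
  shows "finite (- W)"
  using assms unfolding Gm_def
proof (induction arbitrary: c rule: openin_fspace_of_induct)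
  case (Int U V)
  then have "finite (- U)" "finite (- V)" by blast+
  then show ?case by simp
next
  case (UN K)
  then obtain U where "U \<in> K" "c \<in> U" by blast
  then have "finite (- U)" using UN.IH by blast
  then show ?case by (rule rev_finite_subset) (use \<open>U \<in> K\<close> in blast)
next
  case (Basis A h)
  then obtain p where Ah: "A = - {0}" "h = poly p" by blast
  have "poly p c \<noteq> 0" using Basis.prems unfolding Ah by simp
  then have "p \<noteq> 0" by auto
  have "- {x \<in> A. h x \<noteq> 0} \<subseteq> insert 0 {x. poly p x = 0}" unfolding Ah by auto
  then show ?case using poly_roots_finite[OF \<open>p \<noteq> 0\<close>] finite_subset by blast
qed simp

lemma openin_Gm_units: "openin (zar Gm) (- {0})"
proof -
  have "openin (zar Gm) {x \<in> - {0}. poly 1 x \<noteq> 0}"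
    unfolding Gm_def by (rule openin_fspace_of_basic, rule CollectI, rule exI[of _ 1])
      (simp add: fun_eq_iff)
  moreover have "{x \<in> - {0}. poly 1 x \<noteq> 0} = - {0::complex}" by auto
  ultimately show ?thesis by argo
qed

lemma points_Gm: "points Gm = - {0}"
proof
  show "- {0} \<subseteq> points Gm" using openin_Gm_units by (rule openin_subset)
  have "openin (zar Gm) (points Gm)" by simp
  then show "points Gm \<subseteq> - {0}"
    unfolding Gm_def by (induction rule: openin_fspace_of_induct) auto
qed

lemma const_reg_Gm: "(\<lambda>_. 1) \<in> reg Gm (- {0})"
proof -
  have "\<exists>A h k. (A, h) \<in> {(- {0}, poly p) | p. True} \<and> (A, k) \<in> {(- {0}, poly p) | p. True} \<and>
      x \<in> A \<and> k x \<noteq> 0 \<and> (\<forall>y\<in>- {0} \<inter> A. k y \<noteq> 0 \<longrightarrow> 1 = h y / k y)"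
    if "x \<in> - {0}" for x :: complex
    by (rule exI[of _ "- {0}"], rule exI[of _ "poly 1"], rule exI[of _ "poly 1"])
       (use that in auto)
  then show ?thesis
    using openin_Gm_units unfolding Gm_def reg_fspace_of by blast
qed

lemma points_Gm_prod: "space_with_functions T \<Longrightarrow> points (fs_prod Gm T) = (- {0}) \<times> points T"
  using points_fs_prod[of Gm T] const_reg_Gm const_reg by (metis openin_topspace points_Gm)

text \<open>One local quotient suffices for almost all points: its validity is only limited
  by the zeros of the denominator, while the open set \<open>A\<close> is cofinite.  The representation
  is also required to be exact at the given point \<open>c\<close>.\<close>

lemma reg_Gm_rational:
  assumes "f \<in> reg Gm A" "c \<in> A"
  shows "\<exists>p q. poly q c \<noteq> 0 \<and> f c = poly p c / poly q c \<and>
               (\<forall>\<^sub>F y in cofinite. f y = poly p y / poly q y)"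
proof -
  have op: "openin (zar Gm) A" using assms(1) unfolding Gm_def reg_fspace_of by blast
  obtain B h k where "(B, h) \<in> {(- {0}, poly p) | p. True} \<and>
      (B, k) \<in> {(- {0}, poly p) | p. True} \<and> c \<in> B \<and> k c \<noteq> 0 \<and>
      (\<forall>y\<in>A \<inter> B. k y \<noteq> 0 \<longrightarrow> f y = h y / k y)"
    using assms(1)[unfolded Gm_def reg_fspace_of, THEN conjunct2, THEN bspec, OF assms(2)]
    by (elim exE) (rule that)
  then have Bhk: "(B, h) \<in> {(- {0}, poly p) | p. True}" "(B, k) \<in> {(- {0}, poly p) | p. True}"
    and *: "c \<in> B" "k c \<noteq> 0" "\<And>y. y \<in> A \<inter> B \<Longrightarrow> k y \<noteq> 0 \<Longrightarrow> f y = h y / k y"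
    by blast+
  from Bhk obtain p q where B: "B = - {0}" "h = poly p" "k = poly q" by blast
  note pq = *[unfolded B]
  have A: "A \<subseteq> - {0}" using openin_subset[OF op] by (simp add: points_Gm)
  have "\<forall>\<^sub>F y in cofinite. y \<in> A"
    using finite_compl_openin_Gm[OF op assms(2)] by (simp add: eventually_cofinite Compl_eq)
  moreover have "\<forall>\<^sub>F y in cofinite. poly q y \<noteq> 0"
    using pq(2) by (intro eventually_cofinite_poly_neq_0) auto
  ultimately have "\<forall>\<^sub>F y in cofinite. f y = poly p y / poly q y"
    by eventually_elim (use pq(3) A in auto)
  then show ?thesis using pq(2) pq(3)[of c] assms(2) A by blast
qed

lemma sum_reg_Gm_rational:
  assumes "\<And>i. i < m \<Longrightarrow> f i \<in> reg Gm A" "c \<in> A"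
  shows "\<exists>p q. poly q c \<noteq> 0 \<and> (\<Sum>i<(m::nat). f i c * a i) = poly p c / poly q c \<and>
               (\<forall>\<^sub>F y in cofinite. (\<Sum>i<m. f i y * a i) = poly p y / poly q y)"
  using assms(1)
proof (induction m)
  case 0
  show ?case by (rule exI[of _ 0], rule exI[of _ 1])
      (simp add: fun_eq_iff)
next
  case (Suc m)
  obtain p q where pq: "poly q c \<noteq> 0" "(\<Sum>i<m. f i c * a i) = poly p c / poly q c"
    "\<forall>\<^sub>F y in cofinite. (\<Sum>i<m. f i y * a i) = poly p y / poly q y"
    using Suc by fastforce
  obtain p' q' where pq': "poly q' c \<noteq> 0" "f m c = poly p' c / poly q' c"
    "\<forall>\<^sub>F y in cofinite. f m y = poly p' y / poly q' y"
    using reg_Gm_rational[OF Suc.prems[OF lessI] assms(2)] by blast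
  have ne: "\<forall>\<^sub>F y in cofinite. poly q y \<noteq> 0" "\<forall>\<^sub>F y in cofinite. poly q' y \<noteq> 0"
    using pq(1) pq'(1) by (auto intro!: eventually_cofinite_poly_neq_0)
  let ?p = "p * q' + smult (a m) (p' * q)"
  have "\<forall>\<^sub>F y in cofinite. (\<Sum>i<Suc m. f i y * a i) = poly ?p y / poly (q * q') y"
    using pq(3) pq'(3) ne by eventually_elim (simp add: field_simps)
  moreover have "(\<Sum>i<Suc m. f i c * a i) = poly ?p c / poly (q * q') c"
    using pq pq' by (simp add: field_simps)
  moreover have "poly (q * q') c \<noteq> 0" using pq(1) pq'(1) by simp
  ultimately show ?case by blast
qed

text \<open>This is what allows dense open subsets of \<open>\<complex>\<^sup>\<times> \<times> T\<close> to be replaced by cofinitely many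
  parameters at each point.  A sum \<open>\<Sum> f\<^sub>i(x) g\<^sub>i(y)\<close> with \<open>y\<close> fixed agrees almost everywhere with a
  quotient of polynomials, whose numerator is not zero because the quotient is exact at \<open>c\<close>,
  where the sum does not vanish.\<close>

lemma finite_compl_slice_Gm:
  assumes "openin (zar (fs_prod Gm T)) W" "(c, y) \<in> W"
  shows "finite (- {c. (c, y) \<in> W})"
  using assms
proof (induction arbitrary: c rule: openin_fs_prod_induct)
  case (Int U V)
  have "- {c. (c, y) \<in> U \<inter> V} = - {c. (c, y) \<in> U} \<union> - {c. (c, y) \<in> V}" by blast
  moreover have "finite (- {c. (c, y) \<in> U})" "finite (- {c. (c, y) \<in> V})"
    using Int.IH Int.prems by blast+
  ultimately show ?case by (metis finite_Un)
next
  case (UN K)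
  then obtain U where U: "U \<in> K" "(c, y) \<in> U" by blast
  then have "finite (- {c. (c, y) \<in> U})" using UN by blast
  then show ?case by (rule rev_finite_subset) (use U in blast)
next
  case (Basis A B m f g)
  then have c: "c \<in> A" "y \<in> B" "(\<Sum>i<m. f i c * g i y) \<noteq> 0" by auto
  have "\<exists>p q. poly q c \<noteq> 0 \<and> (\<Sum>i<m. f i c * g i y) = poly p c / poly q c \<and>
      (\<forall>\<^sub>F x in cofinite. (\<Sum>i<m. f i x * g i y) = poly p x / poly q x)"
    by (rule sum_reg_Gm_rational[OF _ c(1), where a = "\<lambda>i. g i y"]) (rule Basis(3))
  then obtain p q where pq: "poly q c \<noteq> 0" "(\<Sum>i<m. f i c * g i y) = poly p c / poly q c"
    "\<forall>\<^sub>F x in cofinite. (\<Sum>i<m. f i x * g i y) = poly p x / poly q x"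
    by (elim exE conjE)
  have "p \<noteq> 0" using c pq by auto
  have "\<forall>\<^sub>F x in cofinite. poly p x \<noteq> 0" "\<forall>\<^sub>F x in cofinite. poly q x \<noteq> 0"
    using \<open>p \<noteq> 0\<close> pq by (auto intro!: eventually_cofinite_poly_neq_0)
  moreover have "\<forall>\<^sub>F x in cofinite. x \<in> A"
    using finite_compl_openin_Gm[OF Basis(1) c(1)] by (simp add: eventually_cofinite Compl_eq)
  ultimately have "\<forall>\<^sub>F x in cofinite. (x, y) \<in> {(x, y). x \<in> A \<and> y \<in> B \<and> (\<Sum>i<m. f i x * g i y) \<noteq> 0}"
    using pq(3) by eventually_elim (use c in auto)
  then show ?case by (simp add: eventually_cofinite Compl_eq)
qed simp

section \<open>Generic points of ind-varieties\<close>

lemma ind_variety_swf: "ind_variety X \<Longrightarrow> space_with_functions (X k)"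
  unfolding ind_variety_def variety_def by blast

lemma ind_points_mono:
  assumes "ind_variety X" "k \<le> m" shows "points (X k) \<subseteq> points (X m)"
proof (rule lift_Suc_mono_le[of "\<lambda>j. points (X j)", OF _ assms(2)])
  show "points (X j) \<subseteq> points (X (Suc j))" for j
    using assms(1) unfolding ind_variety_def by (meson closedin_subset)
qed

lemma openin_nested:
  assumes "ind_variety X" "k \<le> m" "openin (zar (X m)) U"
  shows "openin (zar (X k)) (U \<inter> points (X k))"
  using assms(2,3)
proof (induction arbitrary: U rule: dec_induct)
  case base
  then show ?case by (simp add: openin_Int)
next
  case (step m)
  have sub: "X m = fs_restrict (X (Suc m)) (points (X m))"
    using assms(1) unfolding ind_variety_def by blast
  have "zar (X m) = subtopology (zar (X (Suc m))) (points (X m))"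
    by (subst sub) (simp add: fs_restrict_def)
  then have "openin (zar (X m)) (U \<inter> points (X m))"
    by (metis openin_subtopology step.prems)
  moreover have "points (X k) \<subseteq> points (X m)"
    by (rule ind_points_mono[OF assms(1) step.hyps(1)])
  then have "U \<inter> points (X m) \<inter> points (X k) = U \<inter> points (X k)" by blast
  ultimately show ?case using step.IH[of "U \<inter> points (X m)"] by argo
qed

text \<open>It suffices to test all sufficiently large levels.  This is needed for slices, since
  the fixed coordinate belongs to the filtration only from some level on.\<close>

lemma openin_ind_topI:
  assumes "ind_variety X" "U \<subseteq> ind_points X"
    and "\<And>k. m \<le> k \<Longrightarrow> openin (zar (X k)) (U \<inter> points (X k))"
  shows "openin (ind_top X) U"
  unfolding openin_ind_top
proof (intro conjI allI)
  fix k
  have "openin (zar (X k)) (U \<inter> points (X (max k m)) \<inter> points (X k))"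
    by (rule openin_nested[OF assms(1) _ assms(3)]) simp_all
  moreover have "points (X k) \<subseteq> points (X (max k m))"
    by (rule ind_points_mono[OF assms(1)]) simp
  then have "U \<inter> points (X (max k m)) \<inter> points (X k) = U \<inter> points (X k)" by blast
  ultimately show "openin (zar (X k)) (U \<inter> points (X k))" by argo
qed (rule assms(2))

lemma points_ind_prod:
  assumes "ind_variety X" "ind_variety Y"
  shows "points ((X \<times>\<^sub>I Y) k) = points (X k) \<times> points (Y k)"
  unfolding ind_prod_def
  by (rule points_fs_prod; rule const_reg[OF ind_variety_swf openin_topspace]; rule assms)

lemma ind_points_ind_prod_subset:
  assumes "ind_variety X" "ind_variety Y"
  shows "ind_points (X \<times>\<^sub>I Y) \<subseteq> ind_points X \<times> ind_points Y"
  unfolding ind_points_def points_ind_prod[OF assms] by blast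

lemma openin_subset_ind_points: "openin (ind_top X) W \<Longrightarrow> W \<subseteq> ind_points X"
  unfolding openin_ind_top by blast

lemma openin_ind_slice_fst:
  assumes "ind_variety X" "ind_variety Y" "openin (ind_top (X \<times>\<^sub>I Y)) W"
  shows "openin (ind_top X) {x. (x, y) \<in> W}"
proof (cases "\<exists>m. y \<in> points (Y m)")
  case True
  then obtain m where m: "y \<in> points (Y m)" by blast
  have W: "W \<subseteq> ind_points (X \<times>\<^sub>I Y)" "\<And>k. openin (zar ((X \<times>\<^sub>I Y) k)) (W \<inter> points ((X \<times>\<^sub>I Y) k))"
    using assms(3) unfolding openin_ind_top by auto
  show ?thesis
  proof (rule openin_ind_topI[OF assms(1)])
    show "{x. (x, y) \<in> W} \<subseteq> ind_points X"
      using W(1) ind_points_ind_prod_subset[OF assms(1,2)] by blast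
    fix k assume "m \<le> k"
    then have "y \<in> points (Y k)" using m ind_points_mono[OF assms(2)] by blast
    then have "{x. (x, y) \<in> W} \<inter> points (X k) = {x. (x, y) \<in> W \<inter> points ((X \<times>\<^sub>I Y) k)}"
      by (auto simp: points_ind_prod[OF assms(1,2)])
    moreover have "openin (zar (X k)) {x. (x, y) \<in> W \<inter> points ((X \<times>\<^sub>I Y) k)}"
      using openin_slice_fst[OF ind_variety_swf[OF assms(1)], where T = "Y k"] W(2)[of k]
      unfolding ind_prod_def by blast
    ultimately show "openin (zar (X k)) ({x. (x, y) \<in> W} \<inter> points (X k))" by argo
  qed
next
  case False
  have "W \<subseteq> ind_points (X \<times>\<^sub>I Y)" using assms(3) unfolding openin_ind_top by auto
  with False have "{x. (x, y) \<in> W} = {}"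
    using ind_points_ind_prod_subset[OF assms(1,2)] unfolding ind_points_def[of Y] by blast
  then show ?thesis by simp
qed

lemma openin_ind_slice_snd:
  assumes "ind_variety X" "ind_variety Y" "openin (ind_top (X \<times>\<^sub>I Y)) W"
  shows "openin (ind_top Y) {y. (x, y) \<in> W}"
proof (cases "\<exists>m. x \<in> points (X m)")
  case True
  then obtain m where m: "x \<in> points (X m)" by blast
  have W: "W \<subseteq> ind_points (X \<times>\<^sub>I Y)" "\<And>k. openin (zar ((X \<times>\<^sub>I Y) k)) (W \<inter> points ((X \<times>\<^sub>I Y) k))"
    using assms(3) unfolding openin_ind_top by auto
  show ?thesis
  proof (rule openin_ind_topI[OF assms(2)])
    show "{y. (x, y) \<in> W} \<subseteq> ind_points Y"
      using W(1) ind_points_ind_prod_subset[OF assms(1,2)] by blast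
    fix k assume "m \<le> k"
    then have "x \<in> points (X k)" using m ind_points_mono[OF assms(1)] by blast
    then have "{y. (x, y) \<in> W} \<inter> points (Y k) = {y. (x, y) \<in> W \<inter> points ((X \<times>\<^sub>I Y) k)}"
      by (auto simp: points_ind_prod[OF assms(1,2)])
    moreover have "openin (zar (Y k)) {y. (x, y) \<in> W \<inter> points ((X \<times>\<^sub>I Y) k)}"
      using openin_slice_snd[OF ind_variety_swf[OF assms(2)], where S = "X k"] W(2)[of k]
      unfolding ind_prod_def by blast
    ultimately show "openin (zar (Y k)) ({y. (x, y) \<in> W} \<inter> points (Y k))" by argo
  qed
next
  case False
  have "W \<subseteq> ind_points (X \<times>\<^sub>I Y)" using assms(3) unfolding openin_ind_top by auto
  with False have "{y. (x, y) \<in> W} = {}"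
    using ind_points_ind_prod_subset[OF assms(1,2)] unfolding ind_points_def[of X] by blast
  then show ?thesis by simp
qed

lemma openin_ind_box:
  assumes "ind_variety X" "ind_variety Y" "openin (ind_top X) U" "openin (ind_top Y) V"
  shows "openin (ind_top (X \<times>\<^sub>I Y)) {p \<in> ind_points (X \<times>\<^sub>I Y). fst p \<in> U \<and> snd p \<in> V}"
  unfolding openin_ind_top
proof (intro conjI allI)
  fix k
  have *: "{p \<in> ind_points (X \<times>\<^sub>I Y). fst p \<in> U \<and> snd p \<in> V} \<inter> points ((X \<times>\<^sub>I Y) k)
     = (U \<inter> points (X k)) \<times> (V \<inter> points (Y k))"
    using points_ind_prod[OF assms(1,2), of k] unfolding ind_points_def[of "X \<times>\<^sub>I Y"] by auto
  have swf: "space_with_functions (X k)" "space_with_functions (Y k)"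
    by (fact ind_variety_swf[OF assms(1)], fact ind_variety_swf[OF assms(2)])
  have "openin (zar (X k)) (U \<inter> points (X k))" "openin (zar (Y k)) (V \<inter> points (Y k))"
    using assms unfolding openin_ind_top by auto
  then show "openin (zar ((X \<times>\<^sub>I Y) k))
     ({p \<in> ind_points (X \<times>\<^sub>I Y). fst p \<in> U \<and> snd p \<in> V} \<inter> points ((X \<times>\<^sub>I Y) k))"
    unfolding * unfolding ind_prod_def
    by (intro openin_box_fs_prod const_reg swf)
qed auto

text \<open>Projections pull dense open sets back to dense open sets because they are open maps.\<close>

lemma eventually_generic_fst:
  assumes "ind_variety X" "ind_variety Y" "eventually P (generic X)"
  shows "\<forall>\<^sub>F (x, y) in generic (X \<times>\<^sub>I Y). P x"
proof -
  obtain V where V: "dense_open X V" "\<And>x. x \<in> V \<Longrightarrow> P x"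
    using assms(3) unfolding eventually_generic by blast
  let ?W = "{p \<in> ind_points (X \<times>\<^sub>I Y). fst p \<in> V \<and> snd p \<in> ind_points Y}"
  have "dense_open (X \<times>\<^sub>I Y) ?W"
    unfolding dense_open_iff
  proof (intro conjI allI impI)
    show "openin (ind_top (X \<times>\<^sub>I Y)) ?W"
      using V(1) openin_topspace[of "ind_top Y"]
      by (intro openin_ind_box assms) (auto simp: dense_open_def topspace_ind_top)
    fix W assume W: "openin (ind_top (X \<times>\<^sub>I Y)) W \<and> W \<noteq> {}"
    then obtain x y where xy: "(x, y) \<in> W" by fastforce
    have "openin (ind_top X) {x. (x, y) \<in> W}"
      using W by (intro openin_ind_slice_fst[OF assms(1,2)]) auto
    then obtain x' where x': "(x', y) \<in> W" "x' \<in> V"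
      using V(1) xy unfolding dense_open_iff by blast
    have "(x', y) \<in> ind_points (X \<times>\<^sub>I Y)"
      using W x' openin_subset_ind_points by blast
    moreover from this have "y \<in> ind_points Y"
      using ind_points_ind_prod_subset[OF assms(1,2)] by blast
    ultimately show "?W \<inter> W \<noteq> {}" using x' by auto
  qed
  then show ?thesis unfolding eventually_generic using V(2) by auto
qed

lemma eventually_generic_snd:
  assumes "ind_variety X" "ind_variety Y" "eventually P (generic Y)"
  shows "\<forall>\<^sub>F (x, y) in generic (X \<times>\<^sub>I Y). P y"
proof -
  obtain V where V: "dense_open Y V" "\<And>x. x \<in> V \<Longrightarrow> P x"
    using assms(3) unfolding eventually_generic by blast
  let ?W = "{p \<in> ind_points (X \<times>\<^sub>I Y). fst p \<in> ind_points X \<and> snd p \<in> V}"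
  have "dense_open (X \<times>\<^sub>I Y) ?W"
    unfolding dense_open_iff
  proof (intro conjI allI impI)
    show "openin (ind_top (X \<times>\<^sub>I Y)) ?W"
      using V(1) openin_topspace[of "ind_top X"]
      by (intro openin_ind_box assms) (auto simp: dense_open_def topspace_ind_top)
    fix W assume W: "openin (ind_top (X \<times>\<^sub>I Y)) W \<and> W \<noteq> {}"
    then obtain x y where xy: "(x, y) \<in> W" by fastforce
    have "openin (ind_top Y) {y. (x, y) \<in> W}"
      using W by (intro openin_ind_slice_snd[OF assms(1,2)]) auto
    then obtain y' where y': "(x, y') \<in> W" "y' \<in> V"
      using V(1) xy unfolding dense_open_iff by blast
    have "(x, y') \<in> ind_points (X \<times>\<^sub>I Y)"
      using W y' openin_subset_ind_points by blast
    moreover from this have "x \<in> ind_points X"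
      using ind_points_ind_prod_subset[OF assms(1,2)] by blast
    ultimately show "?W \<inter> W \<noteq> {}" using y' by auto
  qed
  then show ?thesis unfolding eventually_generic using V(2) by auto
qed

lemma points_Gm_ind_prod:
  assumes "ind_variety Z"
  shows "points ((Gm_ind \<times>\<^sub>I Z) k) = (- {0}) \<times> points (Z k)"
  unfolding ind_prod_def by (rule points_Gm_prod) (rule ind_variety_swf[OF assms])

lemma ind_points_Gm_ind_prod:
  assumes "ind_variety Z"
  shows "ind_points (Gm_ind \<times>\<^sub>I Z) = (- {0}) \<times> ind_points Z"
  unfolding ind_points_def points_Gm_ind_prod[OF assms] by auto

lemma openin_Gm_slice:
  assumes "openin (ind_top (Gm_ind \<times>\<^sub>I Z)) W" "(c, z) \<in> W"
  shows "\<forall>\<^sub>F c in cofinite. (c, z) \<in> W"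
proof -
  obtain k where k: "(c, z) \<in> points ((Gm_ind \<times>\<^sub>I Z) k)"
    using assms unfolding openin_ind_top ind_points_def by blast
  have "openin (zar (fs_prod Gm (Z k))) (W \<inter> points ((Gm_ind \<times>\<^sub>I Z) k))"
    using assms(1) unfolding openin_ind_top by (auto simp: ind_prod_def)
  from finite_compl_slice_Gm[OF this, of c z]
  have "finite (- {c. (c, z) \<in> W \<inter> points ((Gm_ind \<times>\<^sub>I Z) k)})" using assms k by blast
  then show ?thesis unfolding eventually_cofinite
    by (rule rev_finite_subset) blast
qed

lemma eventually_generic_Gm_slice:
  assumes "ind_variety Z" "eventually P (generic (Gm_ind \<times>\<^sub>I Z))"
  shows "\<forall>\<^sub>F z in generic Z. \<forall>\<^sub>F c in cofinite. P (c, z)"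
proof -
  obtain W where W: "dense_open (Gm_ind \<times>\<^sub>I Z) W" "\<And>p. p \<in> W \<Longrightarrow> P p"
    using assms(2) unfolding eventually_generic by blast
  have opW: "W \<subseteq> ind_points (Gm_ind \<times>\<^sub>I Z)"
      "\<And>k. openin (zar (fs_prod Gm (Z k))) (W \<inter> points ((Gm_ind \<times>\<^sub>I Z) k))"
    using W(1) unfolding dense_open_def openin_ind_top by (auto simp: ind_prod_def)
  let ?V = "{z. \<exists>c. (c, z) \<in> W}"
  have "dense_open Z ?V"
    unfolding dense_open_iff
  proof (intro conjI allI impI)
    show "openin (ind_top Z) ?V"
      unfolding openin_ind_top
    proof (intro conjI allI)
      show "?V \<subseteq> ind_points Z"
        using opW(1) unfolding ind_points_Gm_ind_prod[OF assms(1)] by blast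
      fix k
      have "?V \<inter> points (Z k) = (\<Union>c. {z. (c, z) \<in> W \<inter> points ((Gm_ind \<times>\<^sub>I Z) k)})"
        using opW(1) unfolding ind_points_Gm_ind_prod[OF assms(1)] points_Gm_ind_prod[OF assms(1)]
        by blast
      also have "openin (zar (Z k)) \<dots>"
        by (intro openin_Union) (use openin_slice_snd[OF ind_variety_swf[OF assms(1)] opW(2)] in blast)
      finally show "openin (zar (Z k)) (?V \<inter> points (Z k))" .
    qed
    fix U assume U: "openin (ind_top Z) U \<and> U \<noteq> {}"
    let ?U = "(- {0::complex}) \<times> U"
    have "openin (ind_top (Gm_ind \<times>\<^sub>I Z)) ?U"
      unfolding openin_ind_top
    proof (intro conjI allI)
      show "?U \<subseteq> ind_points (Gm_ind \<times>\<^sub>I Z)"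
        using U openin_subset_ind_points unfolding ind_points_Gm_ind_prod[OF assms(1)] by blast
      fix k
      have "?U \<inter> points ((Gm_ind \<times>\<^sub>I Z) k) = (- {0}) \<times> (U \<inter> points (Z k))"
        unfolding points_Gm_ind_prod[OF assms(1)] by auto
      moreover have "openin (zar (Z k)) (U \<inter> points (Z k))"
        using U unfolding openin_ind_top by blast
      then have "openin (zar (fs_prod Gm (Z k))) ((- {0}) \<times> (U \<inter> points (Z k)))"
        by (intro openin_box_fs_prod openin_Gm_units const_reg_Gm
            const_reg[OF ind_variety_swf[OF assms(1)]])
      ultimately show "openin (zar ((Gm_ind \<times>\<^sub>I Z) k)) (?U \<inter> points ((Gm_ind \<times>\<^sub>I Z) k))"
        by (simp add: ind_prod_def)
    qed
    moreover have "?U \<noteq> {}"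
    proof -
      obtain z where "z \<in> U" using U by blast
      then have "(1, z) \<in> ?U" by simp
      then show ?thesis by blast
    qed
    ultimately have "W \<inter> ?U \<noteq> {}" using W(1) unfolding dense_open_iff by blast
    then show "?V \<inter> U \<noteq> {}" by blast
  qed
  moreover have "\<forall>\<^sub>F c in cofinite. P (c, z)" if z: "z \<in> ?V" for z
  proof -
    obtain c where "(c, z) \<in> W" using z by blast
    with W(1) have "\<forall>\<^sub>F c in cofinite. (c, z) \<in> W"
      unfolding dense_open_def by (intro openin_Gm_slice) auto
    then show ?thesis by (rule eventually_mono) (rule W(2))
  qed
  ultimately show ?thesis unfolding eventually_generic by blast
qed

lemma openin_vimage_rational_map:
  assumes "rational_map X Y f" "openin (ind_top Y) V"
  shows "openin (ind_top X) {x. \<exists>y\<in>V. f x = Some y}"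
  unfolding openin_ind_top
proof (intro conjI allI)
  have dom: "openin (ind_top X) (dom f)"
    using assms(1) unfolding rational_map_def dense_open_def by blast
  then show "{x. \<exists>y\<in>V. f x = Some y} \<subseteq> ind_points X"
    using openin_subset_ind_points by blast
  fix k
  obtain m where m: "fs_morphism (fs_restrict (X k) (dom f \<inter> points (X k))) (Y m) (\<lambda>x. the (f x))"
    using assms(1) unfolding rational_map_def ind_morphism_on_def by blast
  have cont: "continuous_map (subtopology (zar (X k)) (dom f \<inter> points (X k))) (zar (Y m)) (\<lambda>x. the (f x))"
    using m unfolding fs_morphism_def fs_restrict_def by simp
  have D: "openin (zar (X k)) (dom f \<inter> points (X k))"
    using dom unfolding openin_ind_top by blast
  have "openin (zar (Y m)) (V \<inter> points (Y m))"
    using assms(2) unfolding openin_ind_top by blast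
  from openin_continuous_map_preimage[OF cont this]
  have "openin (zar (X k)) {x \<in> dom f \<inter> points (X k). the (f x) \<in> V \<inter> points (Y m)}"
    unfolding openin_open_subtopology[OF D] topspace_subtopology
    by (auto simp: Int_assoc Int_absorb1 openin_subset elim: back_subst[of "openin _"])
  moreover have "the (f x) \<in> points (Y m)" if "x \<in> dom f \<inter> points (X k)" for x
    using continuous_map_image_subset_topspace[OF cont] that by auto
  then have "{x. \<exists>y\<in>V. f x = Some y} \<inter> points (X k) =
      {x \<in> dom f \<inter> points (X k). the (f x) \<in> V \<inter> points (Y m)}" by force
  ultimately show "openin (zar (X k)) ({x. \<exists>y\<in>V. f x = Some y} \<inter> points (X k))" by simp
qed

text \<open>If \<open>g\<close> is a generic inverse of \<open>f\<close> and \<open>U\<close> is open and nonempty, then the preimage of \<open>U\<close> under \<open>g\<close>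
  is open and, since \<open>g \<circ> f\<close> is generically the identity, nonempty.  So it meets the dense set
  \<open>V\<close>, and \<open>g\<close> carries a common point to a point of \<open>U\<close> which \<open>f\<close> maps into \<open>V\<close>.\<close>

lemma eventually_generic_birational:
  assumes "birational_map X Y f" "eventually P (generic Y)"
  shows "\<forall>\<^sub>F x in generic X. \<exists>y. f x = Some y \<and> P y"
proof -
  obtain V where V: "dense_open Y V" "\<And>y. y \<in> V \<Longrightarrow> P y"
    using assms(2) unfolding eventually_generic by blast
  obtain g where f: "rational_map X Y f" and g: "rational_map Y X g"
    "rat_eq X (g \<circ>\<^sub>m f) Some" "rat_eq Y (f \<circ>\<^sub>m g) Some"
    using assms(1) unfolding birational_map_def by blast
  obtain W where W: "dense_open X W" "\<And>x. x \<in> W \<Longrightarrow> (g \<circ>\<^sub>m f) x = Some x"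
    using g(2) unfolding rat_eq_def by blast
  obtain W' where W': "dense_open Y W'" "\<And>x. x \<in> W' \<Longrightarrow> (f \<circ>\<^sub>m g) x = Some x"
    using g(3) unfolding rat_eq_def by blast
  let ?N = "{x. \<exists>y\<in>V. f x = Some y}"
  have "dense_open X ?N"
    unfolding dense_open_iff
  proof (intro conjI allI impI)
    show "openin (ind_top X) ?N"
      using V(1) by (intro openin_vimage_rational_map[OF f]) (auto simp: dense_open_def)
    fix U assume U: "openin (ind_top X) U \<and> U \<noteq> {}"
    then obtain x where x: "x \<in> W" "x \<in> U" using W(1) unfolding dense_open_iff by blast
    let ?M = "{y. \<exists>x\<in>U. g y = Some x}"
    have M: "openin (ind_top Y) ?M" using U by (intro openin_vimage_rational_map[OF g(1)]) auto
    have "?M \<noteq> {}" using W(2)[OF x(1)] x(2) by (auto simp: map_comp_Some_iff)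
    then obtain y where y: "y \<in> V \<inter> W'" "y \<in> ?M"
      using dense_open_Int[OF V(1) W'(1)] M unfolding dense_open_iff by blast
    then obtain x' where "x' \<in> U" "g y = Some x'" by blast
    moreover from this have "f x' = Some y" using W'(2)[of y] y by simp
    ultimately show "?N \<inter> U \<noteq> {}" using y by blast
  qed
  then show ?thesis unfolding eventually_generic using V(2) by blast
qed

text \<open>The orbit of a generic point \<open>z\<close> is generic.  For a dense open \<open>V\<close>, the parameters
  that carry \<open>z\<close> into \<open>V\<close> form an open subset of \<open>\<complex>\<^sup>\<times>\<close>; by the unit law
  it contains \<open>1\<close> as soon as \<open>z \<in> V\<close>, so it is cofinite.\<close>

lemma eventually_generic_act:
  assumes "ind_variety Z" "rational_Gm_action Z e" "eventually P (generic Z)"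
  shows "\<forall>\<^sub>F z in generic Z. \<forall>\<^sub>F c in cofinite. \<exists>z'. e c z = Some z' \<and> P z'"
proof -
  obtain g where g: "rational_map (Gm_ind \<times>\<^sub>I Z) Z g"
    "rat_eq (Gm_ind \<times>\<^sub>I Z) (\<lambda>(c, x). e c x) g" "rat_eq Z (\<lambda>x. g (1, x)) Some"
    using assms(2) unfolding rational_Gm_action_def by blast
  obtain V where V: "dense_open Z V" "\<And>z. z \<in> V \<Longrightarrow> P z"
    using assms(3) unfolding eventually_generic by blast
  have "\<forall>\<^sub>F z in generic Z. z \<in> V" using V(1) unfolding eventually_generic by blast
  moreover have "\<forall>\<^sub>F z in generic Z. \<forall>\<^sub>F c in cofinite. e c z = g (c, z)"
    using eventually_generic_Gm_slice[OF assms(1) g(2)[unfolded rat_eq_iff_generic]]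
    by (rule eventually_mono) (auto elim: eventually_mono)
  ultimately show ?thesis
    using g(3)[unfolded rat_eq_iff_generic]
  proof eventually_elim
    case (elim z)
    let ?W = "{p. \<exists>y\<in>V. g p = Some y}"
    have "openin (ind_top (Gm_ind \<times>\<^sub>I Z)) ?W"
      using V(1) by (intro openin_vimage_rational_map[OF g(1)]) (auto simp: dense_open_def)
    moreover have "(1, z) \<in> ?W" using elim by auto
    ultimately have "\<forall>\<^sub>F c in cofinite. (c, z) \<in> ?W" by (rule openin_Gm_slice)
    with elim(2) show ?case by eventually_elim (use V(2) in auto)
  qed
qed

section \<open>Rational functions that vanish on no component\<close>

text \<open>Unions of chains of irreducible sets are irreducible, so Zorn's lemma applies in every
  topological space.\<close>

lemma ex_irreducible_component:
  assumes "x \<in> topspace T"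
  shows "\<exists>C. irreducible_component_of T C \<and> x \<in> C"
proof -
  let ?A = "{C. irreducible_in T C \<and> x \<in> C}"
  have sing: "{x} \<in> ?A" using assms unfolding irreducible_in_def by auto
  have "\<exists>M\<in>?A. \<forall>C\<in>?A. M \<subseteq> C \<longrightarrow> C = M"
  proof (rule subset_Zorn)
    fix K assume K: "subset.chain ?A K"
    show "\<exists>U\<in>?A. \<forall>C\<in>K. C \<subseteq> U"
    proof (cases "K = {}")
      case True then show ?thesis using sing by blast
    next
      case False
      have KA: "K \<subseteq> ?A" and tot: "\<And>C D. C \<in> K \<Longrightarrow> D \<in> K \<Longrightarrow> C \<subseteq> D \<or> D \<subseteq> C"
        using K unfolding subset_chain_def by auto
      have "irreducible_in T (\<Union>K)"
        unfolding irreducible_in_def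
      proof (intro conjI allI impI)
        show "\<Union>K \<subseteq> topspace T" "\<Union>K \<noteq> {}"
          using KA False unfolding irreducible_in_def by blast+
        fix U V assume UV: "openin T U \<and> openin T V \<and> U \<inter> \<Union>K \<noteq> {} \<and> V \<inter> \<Union>K \<noteq> {}"
        then obtain C D where CD: "C \<in> K" "D \<in> K" "U \<inter> C \<noteq> {}" "V \<inter> D \<noteq> {}" by blast
        then obtain B where B: "B \<in> K" "U \<inter> B \<noteq> {}" "V \<inter> B \<noteq> {}"
          using tot[OF CD(1,2)] by blast
        then have "irreducible_in T B" using KA by blast
        then have "U \<inter> V \<inter> B \<noteq> {}" using UV B unfolding irreducible_in_def by blast
        then show "U \<inter> V \<inter> \<Union>K \<noteq> {}" using B by blast
      qed
      moreover have "x \<in> \<Union>K" using KA False by blast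
      ultimately show ?thesis by blast
    qed
  qed
  then obtain M where M: "irreducible_in T M" "x \<in> M" "\<And>C. C \<in> ?A \<Longrightarrow> M \<subseteq> C \<Longrightarrow> C = M" by blast
  then have "irreducible_component_of T M"
    unfolding irreducible_component_of_def by blast
  then show ?thesis using M by blast
qed

text \<open>An open set \<open>U\<close> meets some component \<open>C\<close>, and so does the open set where \<open>f\<close> is defined and
  nonzero.  As \<open>C\<close> is irreducible, the two open sets meet inside \<open>C\<close>.\<close>

lemma eventually_generic_neq_0:
  assumes "ind_variety X" "rational_function X f" "nonzero_on_components X f"
  shows "\<forall>\<^sub>F x in generic X. \<exists>a. f x = Some a \<and> a \<noteq> 0"
proof -
  let ?N = "{x \<in> dom f. the (f x) \<noteq> 0}"
  have dom: "dense_open X (dom f)" and reg: "\<And>k. (\<lambda>x. the (f x)) \<in> reg (X k) (dom f \<inter> points (X k))"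
    using assms(2) unfolding rational_function_def ind_reg_def by auto
  have N: "openin (ind_top X) ?N"
    unfolding openin_ind_top
  proof (intro conjI allI)
    show "?N \<subseteq> ind_points X" using dom unfolding dense_open_def openin_ind_top by blast
    fix k
    have "?N \<inter> points (X k) = {x \<in> dom f \<inter> points (X k). the (f x) \<noteq> 0}" by blast
    then show "openin (zar (X k)) (?N \<inter> points (X k))"
      using openin_nonvanishing[OF ind_variety_swf[OF assms(1)] reg] by simp
  qed
  have "dense_open X ?N"
    unfolding dense_open_iff
  proof (intro conjI allI impI N)
    fix U assume U: "openin (ind_top X) U \<and> U \<noteq> {}"
    then obtain x where x: "x \<in> U" "x \<in> topspace (ind_top X)"
      unfolding topspace_ind_top using openin_subset_ind_points by blast
    then obtain C where C: "irreducible_component_of (ind_top X) C" "x \<in> C"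
      using ex_irreducible_component by metis
    have "?N \<inter> C \<noteq> {}"
      using assms(3) C(1) unfolding nonzero_on_components_def by fastforce
    moreover have "U \<inter> C \<noteq> {}" using x C by blast
    ultimately have "?N \<inter> U \<inter> C \<noteq> {}"
      using C(1) N U unfolding irreducible_component_of_def irreducible_in_def by blast
    then show "?N \<inter> U \<noteq> {}" by blast
  qed
  then show ?thesis unfolding eventually_generic by (intro exI[of _ ?N]) auto
qed

section \<open>Interval partitions\<close>

lemma finite_interval_partitions: "finite J \<Longrightarrow> finite (interval_partitions J)"
  unfolding interval_partitions_def
  by (rule finite_subset[OF _ finitely_many_partition_on]) auto

lemma interval_partitions_empty: "interval_partitions {} = {{}}"
  unfolding interval_partitions_def by (auto simp: partition_on_empty)

text \<open>The block containing \<open>s\<close> is an initial segment \<open>{s..<k}\<close>; the rest is a partition of \<open>{k..<t}\<close>.\<close>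

lemma interval_partitions_first_block:
  assumes "s < t"
  shows "interval_partitions {s..<t} =
     (\<Union>k\<in>{s<..t}. insert {s..<k} ` interval_partitions {k..<t})"
proof (intro equalityI subsetI)
  fix P assume "P \<in> interval_partitions {s..<t}"
  then have P: "partition_on {s..<t} P" and ivl: "\<And>K. K \<in> P \<Longrightarrow> \<exists>a b. K = {a..b}"
    unfolding interval_partitions_def by auto
  have "s \<in> \<Union>P" using assms partition_onD1[OF P] by auto
  then obtain K where K: "K \<in> P" "s \<in> K" by blast
  then obtain a b where ab: "K = {a..b}" using ivl by blast
  have "K \<subseteq> {s..<t}" using K partition_onD1[OF P] by blast
  moreover have "a \<in> K" "b \<in> K" using K ab by auto
  ultimately have "a \<in> {s..<t}" "b \<in> {s..<t}" by blast+
  then have "a = s" "s \<le> b" "b < t" using K ab by auto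
  then have K': "K = {s..<Suc b}" using ab by auto
  have "partition_on ({s..<t} - K) (P - {K})"
  proof -
    have "disjnt K (\<Union>(P - {K}))"
      using partition_onD2[OF P] K unfolding disjoint_def disjnt_def by blast
    moreover have "insert K (P - {K}) = P" using K by blast
    ultimately show ?thesis using partition_on_insert[of K "P - {K}" "{s..<t}"] P by simp
  qed
  moreover have "{s..<t} - K = {Suc b..<t}" unfolding K' using \<open>s \<le> b\<close> by auto
  ultimately have "P - {K} \<in> interval_partitions {Suc b..<t}"
    unfolding interval_partitions_def using ivl by auto
  moreover have "P = insert {s..<Suc b} (P - {K})" using K K' by auto
  moreover have "Suc b \<in> {s<..t}" using \<open>s \<le> b\<close> \<open>b < t\<close> by auto
  ultimately show "P \<in> (\<Union>k\<in>{s<..t}. insert {s..<k} ` interval_partitions {k..<t})" by blast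
next
  fix P assume "P \<in> (\<Union>k\<in>{s<..t}. insert {s..<k} ` interval_partitions {k..<t})"
  then obtain k Q where k: "s < k" "k \<le> t" and Q: "partition_on {k..<t} Q"
    "\<And>K. K \<in> Q \<Longrightarrow> \<exists>a b. K = {a..b}" and P: "P = insert {s..<k} Q"
    unfolding interval_partitions_def by auto
  have "disjnt {s..<k} (\<Union>Q)"
    unfolding partition_onD1[OF Q(1), symmetric] by (auto simp: disjnt_def)
  moreover have "{s..<t} - {s..<k} = {k..<t}" using k by auto
  ultimately have "partition_on {s..<t} P"
    unfolding P using partition_on_insert[of "{s..<k}" Q "{s..<t}"] Q(1) k by auto
  moreover have "{s..<k} = {s..k - 1}" using k by auto
  ultimately show "P \<in> interval_partitions {s..<t}"
    unfolding interval_partitions_def using Q(2) P by blast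
qed

text \<open>The partition formula for \<open>\<epsilon>\<^sup>*\<close> on the interval \<open>{s..<t}\<close>.  The sign exponent is a sum instead of
  a difference, which has the same parity and is not subject to truncation.\<close>

definition signed_partition_sum :: "(nat set \<Rightarrow> complex) \<Rightarrow> nat \<Rightarrow> nat \<Rightarrow> complex" where
  "signed_partition_sum e s t =
     (\<Sum>P\<in>interval_partitions {s..<t}. (- 1) ^ (t - s + card P) * (\<Prod>K\<in>P. e K))"

lemma signed_partition_sum_refl: "signed_partition_sum e s s = 1"
  unfolding signed_partition_sum_def by (simp add: interval_partitions_empty)

lemma signed_partition_sum_rec:
  assumes "s < t"
  shows "signed_partition_sum e s t =
     - (\<Sum>k\<in>{s<..t}. (- 1) ^ (k - s) * e {s..<k} * signed_partition_sum e k t)"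
proof -
  let ?w = "\<lambda>P. (- 1) ^ (t - s + card P) * (\<Prod>K\<in>P. e K)"
  have part: "partition_on {k..<t} Q" if "Q \<in> interval_partitions {k..<t}" for k Q
    using that unfolding interval_partitions_def by blast
  have sub: "K \<subseteq> {k..<t}" if "Q \<in> interval_partitions {k..<t}" "K \<in> Q" for k Q K
    using partition_onD1[OF part[OF that(1)]] that(2) by blast
  have s_in: "K = {s..<k}" if "Q \<in> interval_partitions {k..<t}" "K \<in> insert {s..<k} Q" "s \<in> K" "s < k"
    for k Q K
  proof -
    have "K \<notin> Q" using sub[OF that(1), of K] that(3,4) by force
    then show ?thesis using that(2) by blast
  qed
  have new: "{s..<k} \<notin> Q" if "Q \<in> interval_partitions {k..<t}" "s < k" for k Q
    using sub[OF that(1), of "{s..<k}"] that(2) by auto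
  have "signed_partition_sum e s t =
      (\<Sum>k\<in>{s<..t}. \<Sum>P\<in>insert {s..<k} ` interval_partitions {k..<t}. ?w P)"
    unfolding signed_partition_sum_def interval_partitions_first_block[OF assms]
  proof (rule sum.UNION_disjoint)
    show "\<forall>k\<in>{s<..t}. \<forall>l\<in>{s<..t}. k \<noteq> l \<longrightarrow>
       insert {s..<k} ` interval_partitions {k..<t} \<inter> insert {s..<l} ` interval_partitions {l..<t} = {}"
    proof (intro ballI impI)
      fix k l assume kl: "k \<in> {s<..t}" "l \<in> {s<..t}" "k \<noteq> l"
      have False if "Q \<in> interval_partitions {k..<t}" "R \<in> interval_partitions {l..<t}"
        "insert {s..<k} Q = insert {s..<l} R" for Q R
      proof -
        have "{s..<k} \<in> insert {s..<l} R" using that(3) by blast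
        then have "{s..<k} = {s..<l}" using s_in[OF that(2)] kl by auto
        then show False using kl by (auto simp: atLeastLessThan_eq_iff)
      qed
      then show "insert {s..<k} ` interval_partitions {k..<t} \<inter>
          insert {s..<l} ` interval_partitions {l..<t} = {}" by blast
    qed
  qed (auto intro: finite_interval_partitions)
  also have "\<dots> = (\<Sum>k\<in>{s<..t}. - ((- 1) ^ (k - s) * e {s..<k} * signed_partition_sum e k t))"
  proof (rule sum.cong[OF refl])
    fix k assume k: "k \<in> {s<..t}"
    have inj: "inj_on (insert {s..<k}) (interval_partitions {k..<t})"
      using new k by (intro inj_onI) (metis greaterThanAtMost_iff insert_ident)
    have "?w (insert {s..<k} Q) =
        - ((- 1) ^ (k - s) * e {s..<k} * ((- 1) ^ (t - k + card Q) * (\<Prod>K\<in>Q. e K)))"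
      if Q: "Q \<in> interval_partitions {k..<t}" for Q
    proof -
      have fin: "finite Q" using part[OF Q] finite_elements by blast
      have "t - s + card (insert {s..<k} Q) = Suc ((k - s) + (t - k + card Q))"
        using fin new[OF Q] k by auto
      moreover have "(\<Prod>K\<in>insert {s..<k} Q. e K) = e {s..<k} * (\<Prod>K\<in>Q. e K)"
        using fin new[OF Q] k by simp
      ultimately show ?thesis by (simp only: power_Suc power_add) (simp add: algebra_simps)
    qed
    then show "(\<Sum>P\<in>insert {s..<k} ` interval_partitions {k..<t}. ?w P) =
        - ((- 1) ^ (k - s) * e {s..<k} * signed_partition_sum e k t)"
      unfolding sum.reindex[OF inj] signed_partition_sum_def
      by (simp add: sum_distrib_left sum_negf)
  qed
  finally show ?thesis by (simp add: sum_negf)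
qed

section \<open>Dual triangular arrays\<close>

text \<open>The values of an epsilon system at one point are arranged in arrays indexed by pairs \<open>s \<le> t\<close> that stand for
  the half-open intervals \<open>{s..<t}\<close>.  With this indexing the empty intervals, where the value is \<open>1\<close>,
  form the diagonal, adjacent intervals share an index, and sums over cut points become matrix
  products of unipotent upper triangular matrices.\<close>

definition conv :: "(nat \<Rightarrow> nat \<Rightarrow> complex) \<Rightarrow> (nat \<Rightarrow> nat \<Rightarrow> complex) \<Rightarrow> nat \<Rightarrow> nat \<Rightarrow> complex" where
  "conv A B s t = (\<Sum>k=s..t. A s k * B k t)"

lemma conv_assoc: "conv (conv A B) C s t = conv A (conv B C) s t"
proof -
  have "conv (conv A B) C s t = (\<Sum>k\<in>{s..t}. \<Sum>m\<in>{m\<in>{s..t}. m \<le> k}. A s m * B m k * C k t)"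
    unfolding conv_def sum_distrib_right by (intro sum.cong) auto
  also have "\<dots> = (\<Sum>m\<in>{s..t}. \<Sum>k\<in>{k\<in>{s..t}. m \<le> k}. A s m * B m k * C k t)"
    by (rule sum.swap_restrict) auto
  also have "\<dots> = conv A (conv B C) s t"
    unfolding conv_def sum_distrib_left by (intro sum.cong) (auto simp: mult.assoc)
  finally show ?thesis .
qed

lemma conv_cong:
  assumes "\<And>k. s \<le> k \<Longrightarrow> k \<le> t \<Longrightarrow> A s k = A' s k"
    and "\<And>k. s \<le> k \<Longrightarrow> k \<le> t \<Longrightarrow> B k t = B' k t"
  shows "conv A B s t = conv A' B' s t"
  unfolding conv_def by (intro sum.cong) (auto simp: assms)

definition delta :: "nat \<Rightarrow> nat \<Rightarrow> complex" where
  "delta s t = (if s = t then 1 else 0)"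

lemma conv_delta: "s \<le> t \<Longrightarrow> conv delta A s t = A s t"
  unfolding conv_def delta_def by (simp add: if_distrib if_distribR cong: if_cong)

definition alternate :: "(nat \<Rightarrow> nat \<Rightarrow> complex) \<Rightarrow> nat \<Rightarrow> nat \<Rightarrow> complex" where
  "alternate e s t = (- 1) ^ (t - s) * e s t"

text \<open>Cutting off the first block in the partition formula gives
  \<open>\<epsilon>\<^sup>*\<^bsub>[s,t]\<^esub> = \<Sum>\<^sub>k (-1)\<^bsup>k-s\<^esup> \<epsilon>\<^bsub>[s,k]\<^esub> \<epsilon>\<^sup>*\<^bsub>[k+1,t]\<^esub>\<close>.  This recursion says that the array of the
  \<open>\<epsilon>\<^sup>*\<close> is a right inverse of the array of the \<open>\<epsilon>\<close> with alternating signs.  Rows and columns run from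
  \<open>1\<close> to \<open>n + 1\<close>.\<close>

definition dual_arrays ::
  "nat \<Rightarrow> (nat \<Rightarrow> nat \<Rightarrow> complex) \<Rightarrow> (nat \<Rightarrow> nat \<Rightarrow> complex) \<Rightarrow> bool" where
  "dual_arrays n e e' \<longleftrightarrow> (\<forall>s. e s s = 1 \<and> e' s s = 1) \<and>
     (\<forall>s t. 1 \<le> s \<and> s \<le> t \<and> t \<le> Suc n \<longrightarrow> conv (alternate e) e' s t = delta s t)"

lemma sum_split_first:
  fixes f :: "nat \<Rightarrow> complex"
  shows "s \<le> t \<Longrightarrow> sum f {s..t} = f s + sum f {Suc s..t}"
  by (rule sum.atLeast_Suc_atMost)

text \<open>For unipotent triangular matrices a right inverse is a left inverse.  With \<open>A\<close> the array of the \<open>\<epsilon>\<close> with signs and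
  \<open>M\<close> the product in question, \<open>A M = A\<close> by associativity, and \<open>A\<close> can be cancelled row by row, starting
  from the diagonal.\<close>

lemma dual_arrays_right:
  assumes "dual_arrays n e e'" "1 \<le> s" "s \<le> t" "t \<le> Suc n"
  shows "conv e' (alternate e) s t = delta s t"
  using assms(2,3)
proof (induction "t - s" arbitrary: s rule: less_induct)
  case less
  let ?A = "alternate e" and ?M = "conv e' (alternate e)"
  have diag: "?A s s = 1" "e' s s = 1"
    using assms(1) unfolding dual_arrays_def alternate_def by auto
  show ?case
  proof (cases "s = t")
    case True
    then show ?thesis using diag unfolding conv_def delta_def by simp
  next
    case False
    then have st: "s < t" using less.prems by simp
    have "conv ?A ?M s t = conv (conv ?A e') ?A s t" by (rule conv_assoc[symmetric])
    also have "\<dots> = conv delta ?A s t"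
      using assms(1,4) less.prems unfolding dual_arrays_def by (intro conv_cong) auto
    also have "\<dots> = ?A s t" using st by (intro conv_delta) simp
    finally have "?M s t + (\<Sum>k=Suc s..t. ?A s k * ?M k t) = ?A s t"
      using st diag by (subst (asm) conv_def, subst (asm) sum_split_first) simp_all
    moreover have "(\<Sum>k=Suc s..t. ?A s k * ?M k t) = (\<Sum>k=Suc s..t. ?A s k * delta k t)"
      using less.hyps less.prems by (intro sum.cong) auto
    moreover have "(\<Sum>k=Suc s..t. ?A s k * delta k t) = ?A s t"
      using st unfolding delta_def by (simp add: if_distrib cong: if_cong)
    ultimately show ?thesis using st unfolding delta_def by simp
  qed
qed

lemma dual_arrays_adjacent:
  assumes "dual_arrays n e e'" "1 \<le> s" "s \<le> n"
  shows "e' s (Suc s) = e s (Suc s)"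
proof -
  have "conv (alternate e) e' s (Suc s) = 0" "e s s = 1" "e' (Suc s) (Suc s) = 1"
    using assms unfolding dual_arrays_def delta_def by auto
  then show ?thesis unfolding conv_def alternate_def by simp
qed

section \<open>Transformation of dual arrays under a crystal operator\<close>

text \<open>The transformation rules of an epsilon system under the operator with index \<open>i\<close> and parameter \<open>c\<close>, in terms of
  half-open intervals: \<open>t\<close> is one more than the last element.  The arrays \<open>e, e'\<close> belong to
  the point before the action and \<open>f, f'\<close> to the point after it.\<close>

definition arrays_moved :: "nat \<Rightarrow> nat \<Rightarrow> complex \<Rightarrow> (nat \<Rightarrow> nat \<Rightarrow> complex) \<Rightarrow>
    (nat \<Rightarrow> nat \<Rightarrow> complex) \<Rightarrow> (nat \<Rightarrow> nat \<Rightarrow> complex) \<Rightarrow> (nat \<Rightarrow> nat \<Rightarrow> complex) \<Rightarrow> bool" where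
  "arrays_moved n i c e e' f f' \<longleftrightarrow>
     (\<forall>s t. 1 \<le> s \<and> s < t \<and> t \<le> Suc n \<longrightarrow>
        (i = s \<longrightarrow> f s t = e s t / c) \<and>
        (i \<notin> {s - 1, s, t} \<longrightarrow> f s t = e s t) \<and>
        (Suc i = t \<longrightarrow> f' s t = e' s t / c) \<and>
        (i \<notin> {s - 1, t - 1, t} \<longrightarrow> f' s t = e' s t))"

lemma sum_split_two:
  fixes f :: "nat \<Rightarrow> complex"
  shows "s < t \<Longrightarrow> sum f {s..t} = f s + f (Suc s) + sum f {Suc (Suc s)..t}"
  using sum_split_first[of s t f] sum_split_first[of "Suc s" t f] by simp

text \<open>The entry \<open>(s, t)\<close> of the identity \<open>\<epsilon>\<^sup>* \<cdot> (\<plusminus>\<epsilon>) = 1\<close> is a sum over cut points \<open>k\<close>.  All terms with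
  \<open>k > s + 1\<close> are invariant under the operator \<open>e\<^sub>s\<close>, hence so is the sum of the remaining two.  This determines how
  \<open>\<epsilon>\<^bsub>[s+1,t-1]\<^esub>\<close> changes, about which the transformation rules say nothing.\<close>

lemma arrays_moved_next:
  assumes "dual_arrays n e e'" "dual_arrays n f f'" "arrays_moved n s c e e' f f'"
    and "1 \<le> s" "s < t" "t \<le> Suc n"
  shows "f s (Suc s) * f (Suc s) t - f s t = e s (Suc s) * e (Suc s) t - e s t"
proof (cases "t = Suc s")
  case True
  then show ?thesis using assms(1,2) unfolding dual_arrays_def by simp
next
  case False
  then have st: "Suc s < t" using assms by simp
  have m: "(- 1) ^ (t - s) = - ((- 1) ^ (t - Suc s) :: complex)"
    using st by (metis Suc_diff_Suc Suc_lessD mult_minus1 power_Suc)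
  have split: "(\<Sum>k=Suc (Suc s)..t. g' s k * alternate g k t) =
      (- 1) ^ (t - Suc s) * (g s t - g s (Suc s) * g (Suc s) t)" if "dual_arrays n g g'" for g g'
  proof -
    have "conv g' (alternate g) s t = 0"
      using dual_arrays_right[OF that assms(4) _ assms(6)] st by (simp add: delta_def)
    moreover have "g' s (Suc s) = g s (Suc s)" "g' s s = 1"
      using dual_arrays_adjacent[OF that assms(4)] that assms st unfolding dual_arrays_def by auto
    ultimately show ?thesis
      using m st by (simp add: conv_def sum_split_two alternate_def algebra_simps)
  qed
  have "(\<Sum>k=Suc (Suc s)..t. f' s k * alternate f k t) = (\<Sum>k=Suc (Suc s)..t. e' s k * alternate e k t)"
  proof (rule sum.cong[OF refl])
    fix k assume k: "k \<in> {Suc (Suc s)..t}"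
    have "s \<notin> {s - 1, k - 1, k}" "1 \<le> s \<and> s < k \<and> k \<le> Suc n" using k assms by auto
    then have "f' s k = e' s k" using assms(3) unfolding arrays_moved_def by blast
    moreover have "f k t = e k t"
    proof (cases "k = t")
      case True then show ?thesis using assms(1,2) unfolding dual_arrays_def by simp
    next
      case False
      then have "s \<notin> {k - 1, k, t}" "1 \<le> k \<and> k < t \<and> t \<le> Suc n" using k assms by auto
      then show ?thesis using assms(3) unfolding arrays_moved_def by blast
    qed
    ultimately show "f' s k * alternate f k t = e' s k * alternate e k t"
      by (simp add: alternate_def)
  qed
  then have "(- 1) ^ (t - Suc s) * (f s t - f s (Suc s) * f (Suc s) t) =
      (- 1 :: complex) ^ (t - Suc s) * (e s t - e s (Suc s) * e (Suc s) t)"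
    unfolding split[OF assms(1)] split[OF assms(2)] .
  then have "f s t - f s (Suc s) * f (Suc s) t = e s t - e s (Suc s) * e (Suc s) t" by simp
  then show ?thesis by (simp add: algebra_simps)
qed

text \<open>The same argument for the identity \<open>(\<plusminus>\<epsilon>) \<cdot> \<epsilon>\<^sup>* = 1\<close>, where the terms with \<open>k > s + 1\<close> are all divided
  by \<open>c\<close>.\<close>

lemma arrays_moved_next_star:
  assumes "dual_arrays n e e'" "dual_arrays n f f'" "arrays_moved n s c e e' f f'"
    and "1 \<le> s" "Suc s < t" "t \<le> Suc n"
  shows "e' s t - f s (Suc s) * f' (Suc s) t = (e' s t - e s (Suc s) * e' (Suc s) t) / c"
proof -
  have split: "(\<Sum>k=Suc (Suc s)..t. alternate g s k * g' k t) =
      - (g' s t - g s (Suc s) * g' (Suc s) t)" if "dual_arrays n g g'" for g g'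
  proof -
    have "conv (alternate g) g' s t = 0" "g s s = 1"
      using that assms unfolding dual_arrays_def delta_def by auto
    then show ?thesis
      using assms by (simp add: conv_def sum_split_two alternate_def algebra_simps add_eq_0_iff)
  qed
  have "(\<Sum>k=Suc (Suc s)..t. alternate f s k * f' k t) =
      (\<Sum>k=Suc (Suc s)..t. alternate e s k * e' k t / c)"
  proof (rule sum.cong[OF refl])
    fix k assume k: "k \<in> {Suc (Suc s)..t}"
    then have "f s k = e s k / c" using assms(3-6) unfolding arrays_moved_def by auto
    moreover have "f' k t = e' k t"
    proof (cases "k = t")
      case True then show ?thesis using assms(1,2) unfolding dual_arrays_def by simp
    next
      case False
      then have "s \<notin> {k - 1, t - 1, t}" "1 \<le> k \<and> k < t \<and> t \<le> Suc n" using k assms by auto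
      then show ?thesis using assms(3) unfolding arrays_moved_def by blast
    qed
    ultimately show "alternate f s k * f' k t = alternate e s k * e' k t / c"
      by (simp add: alternate_def)
  qed
  then have "- (f' s t - f s (Suc s) * f' (Suc s) t) = - (e' s t - e s (Suc s) * e' (Suc s) t) / c"
    by (simp only: split[OF assms(1)] split[OF assms(2)] sum_divide_distrib[symmetric])
  then have "f' s t - f s (Suc s) * f' (Suc s) t = (e' s t - e s (Suc s) * e' (Suc s) t) / c"
    by (metis minus_divide_left neg_equal_iff_equal)
  moreover have "f' s t = e' s t"
  proof -
    have "s \<notin> {s - 1, t - 1, t}" "1 \<le> s \<and> s < t \<and> t \<le> Suc n" using assms by auto
    then show ?thesis using assms(3) unfolding arrays_moved_def by blast
  qed
  ultimately show ?thesis by simp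
qed

section \<open>Products of dual arrays\<close>

text \<open>The formulas of the product epsilon system for the pair \<open>(x, y)\<close>, where \<open>e\<close> stands for values at \<open>x\<close>, \<open>f\<close>
  for values at \<open>y\<close>, and \<open>g\<close> for the functions \<open>\<gamma>\<^sub>j\<close> at \<open>x\<close>.\<close>

definition prod_array :: "(nat \<Rightarrow> complex) \<Rightarrow> (nat \<Rightarrow> nat \<Rightarrow> complex) \<Rightarrow> (nat \<Rightarrow> nat \<Rightarrow> complex) \<Rightarrow>
    nat \<Rightarrow> nat \<Rightarrow> complex" where
  "prod_array g e f s t = (\<Sum>k=s..t. f s k * e k t / (\<Prod>j=s..<k. g j))"

definition prod_array_star :: "(nat \<Rightarrow> complex) \<Rightarrow> (nat \<Rightarrow> nat \<Rightarrow> complex) \<Rightarrow>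
    (nat \<Rightarrow> nat \<Rightarrow> complex) \<Rightarrow> nat \<Rightarrow> nat \<Rightarrow> complex" where
  "prod_array_star g e' f' s t = (\<Sum>k=s..t. e' s k * f' k t / (\<Prod>j=k..<t. g j))"

text \<open>Let \<open>F\<close> and \<open>F'\<close> be the two arrays of \<open>y\<close> conjugated by a diagonal matrix whose successive
  quotients are the \<open>\<gamma>\<^sub>j\<close>.  Then the product arrays are \<open>F \<cdot> (\<plusminus>e)\<close> and \<open>e' \<cdot> F'\<close>, and the inner factors cancel.\<close>

lemma dual_arrays_prod:
  assumes "dual_arrays n e e'" "dual_arrays n f f'"
  shows "dual_arrays n (prod_array g e f) (prod_array_star g e' f')"
proof -
  let ?F = "\<lambda>s t. alternate f s t / (\<Prod>j=s..<t. g j)" and ?F' = "\<lambda>s t. f' s t / (\<Prod>j=s..<t. g j)"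
  have alt: "alternate (prod_array g e f) s t = conv ?F (alternate e) s t" for s t
  proof -
    have "(- 1 :: complex) ^ (t - s) = (- 1) ^ (k - s) * (- 1) ^ (t - k)" if "k \<in> {s..t}" for k
      using that by (simp flip: power_add)
    then show ?thesis
      unfolding alternate_def prod_array_def conv_def sum_distrib_left
      by (intro sum.cong) simp_all
  qed
  have star: "prod_array_star g e' f' s t = conv e' ?F' s t" for s t
    unfolding prod_array_star_def conv_def by simp
  have "conv (alternate (prod_array g e f)) (prod_array_star g e' f') s t = delta s t"
    if st: "1 \<le> s" "s \<le> t" "t \<le> Suc n" for s t
  proof -
    have "conv (alternate (prod_array g e f)) (prod_array_star g e' f') s t =
        conv (conv ?F (alternate e)) (conv e' ?F') s t"
      by (intro conv_cong alt star)
    also have "\<dots> = conv ?F (conv (conv (alternate e) e') ?F') s t"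
      unfolding conv_assoc[of ?F] by (intro conv_cong refl conv_assoc[symmetric])
    also have "\<dots> = conv ?F (conv delta ?F') s t"
      using assms(1) st unfolding dual_arrays_def by (intro conv_cong refl) auto
    also have "\<dots> = conv ?F ?F' s t"
      by (intro conv_cong refl conv_delta)
    also have "\<dots> = (\<Sum>k=s..t. alternate f s k * f' k t / (\<Prod>j=s..<t. g j))"
      unfolding conv_def
    proof (rule sum.cong[OF refl])
      fix k assume "k \<in> {s..t}"
      then have "prod g {s..<t} = prod g {s..<k} * prod g {k..<t}"
        by (simp add: prod.atLeastLessThan_concat)
      then show "alternate f s k / prod g {s..<k} * (f' k t / prod g {k..<t}) =
          alternate f s k * f' k t / prod g {s..<t}" by simp
    qed
    also have "\<dots> = delta s t / (\<Prod>j=s..<t. g j)"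
      using assms(2) st unfolding dual_arrays_def by (auto simp: conv_def simp flip: sum_divide_distrib)
    also have "\<dots> = delta s t" unfolding delta_def by simp
    finally show ?thesis .
  qed
  moreover have "prod_array g e f s s = 1 \<and> prod_array_star g e' f' s s = 1" for s
    using assms unfolding dual_arrays_def prod_array_def prod_array_star_def by simp
  ultimately show ?thesis unfolding dual_arrays_def by blast
qed

definition weights_moved :: "nat \<Rightarrow> nat \<Rightarrow> complex \<Rightarrow> (nat \<Rightarrow> complex) \<Rightarrow> (nat \<Rightarrow> complex) \<Rightarrow> bool" where
  "weights_moved n i c g h \<longleftrightarrow> (\<forall>j\<in>{1..n}. h j = c powi cartan i j * g j)"

text \<open>The weights \<open>\<gamma>\<^sub>s\<close> and \<open>\<gamma>\<^bsub>s+1\<^esub>\<close> are multiplied by \<open>c\<^sup>2\<close> and \<open>c\<^sup>-\<^sup>1\<close>, the later ones are fixed.\<close>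

lemma weights_moved_prod:
  assumes "weights_moved n s c g h" "c \<noteq> 0" "1 \<le> s"
  shows "Suc s < t \<Longrightarrow> t \<le> Suc n \<Longrightarrow> prod h {s..<t} = c * prod g {s..<t}"
    and "Suc s < t \<Longrightarrow> t \<le> Suc n \<Longrightarrow> prod h {Suc s..<t} = prod g {Suc s..<t} / c"
    and "Suc s < k \<Longrightarrow> t \<le> Suc n \<Longrightarrow> prod h {k..<t} = prod g {k..<t}"
proof -
  show far: "prod h {k..<t} = prod g {k..<t}" if "Suc s < k" "t \<le> Suc n" for k t
    using assms that unfolding weights_moved_def by (intro prod.cong) (auto simp: cartan_def)
  show next_1: "prod h {Suc s..<t} = prod g {Suc s..<t} / c" if "Suc s < t" "t \<le> Suc n" for t
  proof -
    have "h (Suc s) = g (Suc s) / c"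
      using assms that unfolding weights_moved_def
      by (auto simp: cartan_def power_int_minus field_simps)
    then show ?thesis using that far[of "Suc (Suc s)" t]
      by (simp add: prod.atLeast_Suc_lessThan)
  qed
  show "prod h {s..<t} = c * prod g {s..<t}" if "Suc s < t" "t \<le> Suc n" for t
  proof -
    have "h s = c ^ 2 * g s"
      using assms that unfolding weights_moved_def by (auto simp: cartan_def)
    then show ?thesis using that next_1[OF that] assms(2)
      by (simp add: prod.atLeast_Suc_lessThan[of s t] power2_eq_square)
  qed
qed

text \<open>In both sums over cut points \<open>k\<close> every term with \<open>k > s + 1\<close> transforms as claimed: in the first sum by
  \<open>c\<^sub>2\<^sup>-\<^sup>1 c\<^sub>1\<^sup>-\<^sup>1 = c\<^sup>-\<^sup>1\<close>, in the second one trivially.  The terms with \<open>k = s\<close> and \<open>k = s + 1\<close> have to be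
  treated together.  The relations of the preceding section give the new value of the array for
  \<open>[s+1,t-1]\<close>, after division by \<open>\<epsilon>\<^sub>s\<close> of the first factor in the one case and of the second factor in the
  other, and the claim becomes the defining equation of \<open>c\<^sub>1\<close>.\<close>

lemma prod_arrays_moved:
  assumes e: "dual_arrays n e0 e0'" "dual_arrays n e e'" "arrays_moved n s c1 e0 e0' e e'"
    and f: "dual_arrays n f0 f0'" "dual_arrays n f f'" "arrays_moved n s c2 f0 f0' f f'"
    and g: "weights_moved n s c1 g0 g" "\<And>j. j \<in> {1..n} \<Longrightarrow> g0 j \<noteq> 0"
    and st: "1 \<le> s" "Suc s < t" "t \<le> Suc n"
    and ne: "e0 s (Suc s) \<noteq> 0" "f0 s (Suc s) \<noteq> 0" "c \<noteq> 0" "c1 \<noteq> 0" "c2 = c / c1"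
    and c1: "c1 * (g0 s * e0 s (Suc s) + f0 s (Suc s)) = c * g0 s * e0 s (Suc s) + f0 s (Suc s)"
  shows "prod_array g e f s t = prod_array g0 e0 f0 s t / c"
    and "prod_array_star g e' f' s t = prod_array_star g0 e0' f0' s t"
proof -
  have s: "s \<in> {1..n}" using st by auto
  have gs: "g0 s \<noteq> 0" "g s = c1 ^ 2 * g0 s"
    using g s unfolding weights_moved_def by (auto simp: cartan_def)
  have c2: "c2 \<noteq> 0" "c1 * c2 = c" using ne by auto
  define a where "a = e0 s (Suc s)"
  define b where "b = f0 s (Suc s)"
  note ne' = ne[folded a_def b_def] and c1' = c1[folded a_def b_def]
  have diag: "e0 k k = 1" "e k k = 1" "f0 k k = 1" "f k k = 1"
    "e0' k k = 1" "e' k k = 1" "f0' k k = 1" "f' k k = 1" for k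
    using e f unfolding dual_arrays_def by auto
  have moved: "e s k = e0 s k / c1" "f s k = f0 s k / c2" if "s < k" "k \<le> Suc n" for k
    using e(3) f(3) that st unfolding arrays_moved_def by auto
  have fixed: "e k t = e0 k t" "f' k t = f0' k t" if "Suc s < k" "k \<le> t" for k
  proof -
    have "k = t \<or> (1 \<le> k \<and> k < t \<and> t \<le> Suc n) \<and> s \<notin> {k - 1, k, t} \<and> s \<notin> {k - 1, t - 1, t}"
      using that st by auto
    then consider "k = t" |
      "1 \<le> k \<and> k < t \<and> t \<le> Suc n" "s \<notin> {k - 1, k, t}" "s \<notin> {k - 1, t - 1, t}"
      by blast
    then show "e k t = e0 k t" "f' k t = f0' k t"
      using e(3) f(3) diag unfolding arrays_moved_def by (cases; metis)+
  qed
  have fixed_star: "e' s k = e0' s k" "f' s k = f0' s k" if "Suc s < k" "k \<le> Suc n" for k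
  proof -
    have "1 \<le> s \<and> s < k \<and> k \<le> Suc n" "s \<notin> {s - 1, k - 1, k}" using that st by auto
    then show "e' s k = e0' s k" "f' s k = f0' s k"
      using e(3) f(3) unfolding arrays_moved_def by metis+
  qed
  have adj: "e' s (Suc s) = a / c1" "e0' s (Suc s) = a"
    using dual_arrays_adjacent[OF e(1) st(1)] dual_arrays_adjacent[OF e(2) st(1)] moved(1)[of "Suc s"] s
    unfolding a_def by auto
  note pr = weights_moved_prod[OF g(1) ne(4) st(1)]
  show "prod_array g e f s t = prod_array g0 e0 f0 s t / c"
  proof -
    have rest: "(\<Sum>k=Suc (Suc s)..t. f s k * e k t / prod g {s..<k}) =
        (\<Sum>k=Suc (Suc s)..t. f0 s k * e0 k t / prod g0 {s..<k}) / c"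
      unfolding sum_divide_distrib
    proof (rule sum.cong[OF refl])
      fix k assume k: "k \<in> {Suc (Suc s)..t}"
      then have "prod g {s..<k} = c1 * prod g0 {s..<k}" using st by (intro pr) auto
      then show "f s k * e k t / prod g {s..<k} = f0 s k * e0 k t / prod g0 {s..<k} / c"
        using moved(2)[of k] fixed(1)[of k] k st by (simp add: c2(2)[symmetric] mult_ac)
    qed
    have nxt: "a / c1 * e (Suc s) t - e0 s t / c1 = a * e0 (Suc s) t - e0 s t"
      using arrays_moved_next[OF e st(1) _ st(3)] moved(1)[of "Suc s"] moved(1)[of t] st
      unfolding a_def by simp
    \<comment> \<open>The equation \<open>nxt\<close> with denominators cleared determines \<open>x\<close>, the new value.\<close>
    define x where "x = e (Suc s) t"
    define y where "y = e0 (Suc s) t"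
    define z where "z = e0 s t"
    have x: "a * x = c1 * (a * y - z) + z"
      using nxt ne' unfolding x_def y_def z_def by (simp add: field_simps)
    have first: "e s t + f s (Suc s) * x / g s = (z + b * y / g0 s) / c"
    proof -
      \<comment> \<open>Multiplying by \<open>a\<close> makes \<open>a * x\<close> appear, which can be eliminated.\<close>
      have nz: "a * g0 s * c1 * c \<noteq> 0" using ne' gs by simp
      have "a * g0 s * c1 * c * (z / c1 + b / c2 * x / (c1 ^ 2 * g0 s)) = a * g0 s * c * z + b * (a * x)"
        using ne' gs c2 by (simp add: field_simps power2_eq_square)
      also have "\<dots> = c1 * (b * (a * y - z)) + (c * g0 s * a + b) * z"
        unfolding x by (simp add: algebra_simps)
      also have "\<dots> = a * g0 s * c1 * c * ((z + b * y / g0 s) / c)"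
        unfolding c1'[symmetric] using ne' gs by (simp add: field_simps)
      finally have "z / c1 + b / c2 * x / (c1 ^ 2 * g0 s) = (z + b * y / g0 s) / c"
        using nz by (metis mult_cancel_left)
      then show ?thesis
        using moved(1)[of t] moved(2)[of "Suc s"] st unfolding gs(2) z_def b_def by simp
    qed
    show ?thesis
      using st first rest unfolding prod_array_def x_def y_def z_def b_def
      by (simp add: sum_split_two diag add_divide_distrib)
  qed
  show "prod_array_star g e' f' s t = prod_array_star g0 e0' f0' s t"
  proof -
    have rest: "(\<Sum>k=Suc (Suc s)..t. e' s k * f' k t / prod g {k..<t}) =
        (\<Sum>k=Suc (Suc s)..t. e0' s k * f0' k t / prod g0 {k..<t})"
    proof (rule sum.cong[OF refl])
      fix k assume k: "k \<in> {Suc (Suc s)..t}"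
      then have "prod g {k..<t} = prod g0 {k..<t}" using st by (intro pr) auto
      then show "e' s k * f' k t / prod g {k..<t} = e0' s k * f0' k t / prod g0 {k..<t}"
        using fixed_star(1)[of k] fixed(2)[of k] k st by simp
    qed
    define x where "x = f' (Suc s) t"
    define y where "y = f0' (Suc s) t"
    define z where "z = f0' s t"
    define p where "p = prod g0 {Suc s..<t}"
    have p: "p \<noteq> 0" unfolding p_def using g(2) st by auto
    have "z - b / c2 * x = (z - b * y) / c2"
      using arrays_moved_next_star[OF f st] moved(2)[of "Suc s"] s
      unfolding x_def y_def z_def b_def by simp
    then have x: "b * x = c2 * z - z + b * y"
      using c2 by (simp add: field_simps)
    have first: "z / (c1 * (g0 s * p)) + a / c1 * x / (p / c1) = z / (g0 s * p) + a * y / p"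
    proof -
      have "b * g0 s * p * c1 * (z / (c1 * (g0 s * p)) + a / c1 * x / (p / c1)) =
          b * z + c1 * g0 s * a * (b * x)"
        using ne' gs p by (simp add: field_simps)
      also have "\<dots> = (c * g0 s * a + b) * z + c1 * g0 s * a * (b * y - z)"
        unfolding x c2(2)[symmetric] by (simp add: algebra_simps)
      also have "\<dots> = b * g0 s * p * c1 * (z / (g0 s * p) + a * y / p)"
        unfolding c1'[symmetric] using ne' gs p by (simp add: field_simps)
      finally show ?thesis using ne' gs p by simp
    qed
    have "prod g {s..<t} = c1 * (g0 s * p)" "prod g {Suc s..<t} = p / c1"
      "prod g0 {s..<t} = g0 s * p"
      using pr(1,2)[OF st(2,3)] st unfolding p_def by (auto simp: prod.atLeast_Suc_lessThan[of s t])
    moreover have "f' s t = z" using fixed_star(2)[of t] st unfolding z_def by simp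
    ultimately show ?thesis
      using st first rest adj unfolding prod_array_star_def x_def y_def
      by (simp add: sum_split_two diag z_def p_def)
  qed
qed

section \<open>Generic points on orbits\<close>

text \<open>Conditions on pairs \<open>(c, z)\<close> that hold, for generic \<open>z\<close>, for all but finitely many \<open>c\<close>.  This is weaker
  than holding on a dense open subset of \<open>\<complex>\<^sup>\<times> \<times> Z\<close>, since no openness in both variables is
  demanded; in return it can be pulled back along substitutions of the parameter that depend on \<open>z\<close>.\<close>

definition orbit_generic :: "'a ind \<Rightarrow> (complex \<times> 'a) filter" where
  "orbit_generic Z = Abs_filter (\<lambda>P. \<forall>\<^sub>F z in generic Z. \<forall>\<^sub>F c in cofinite. P (c, z))"

lemma eventually_orbit_generic:
  "eventually P (orbit_generic Z) \<longleftrightarrow> (\<forall>\<^sub>F z in generic Z. \<forall>\<^sub>F c in cofinite. P (c, z))"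
  unfolding orbit_generic_def
proof (rule eventually_Abs_filter, unfold_locales)
  fix P Q :: "complex \<times> 'a \<Rightarrow> bool"
  assume "\<forall>\<^sub>F z in generic Z. \<forall>\<^sub>F c in cofinite. P (c, z)"
    "\<forall>\<^sub>F z in generic Z. \<forall>\<^sub>F c in cofinite. Q (c, z)"
  then show "\<forall>\<^sub>F z in generic Z. \<forall>\<^sub>F c in cofinite. P (c, z) \<and> Q (c, z)"
    by eventually_elim (rule eventually_conj)
next
  fix P Q :: "complex \<times> 'a \<Rightarrow> bool"
  assume PQ: "\<forall>p. P p \<longrightarrow> Q p" and "\<forall>\<^sub>F z in generic Z. \<forall>\<^sub>F c in cofinite. P (c, z)"
  from this(2) show "\<forall>\<^sub>F z in generic Z. \<forall>\<^sub>F c in cofinite. Q (c, z)"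
    by eventually_elim (use PQ in \<open>auto elim: eventually_mono\<close>)
qed simp

text \<open>In this form the identities between rational maps on \<open>\<complex>\<^sup>\<times> \<times> Z\<close> enter the proof.\<close>

lemma rat_eq_orbit_generic:
  assumes "ind_variety Z" "rat_eq (Gm_ind \<times>\<^sub>I Z) (\<lambda>(c, z). f c z) (\<lambda>(c, z). g c z)"
  shows "\<forall>\<^sub>F (c, z) in orbit_generic Z. \<exists>y. f c z = Some y \<and> g c z = Some y"
  unfolding eventually_orbit_generic
  using eventually_generic_Gm_slice[OF assms(1) assms(2)[unfolded rat_eq_iff_generic]] by simp

lemma eventually_orbit_generic_point:
  "eventually P (generic Z) \<Longrightarrow> \<forall>\<^sub>F (c, z) in orbit_generic Z. P z"
  unfolding eventually_orbit_generic by simp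

lemma eventually_generic_of_orbit:
  assumes "\<forall>\<^sub>F (c, z) in orbit_generic Z. P z"
  shows "eventually P (generic Z)"
  using assms unfolding eventually_orbit_generic by (simp add: eventually_const_iff infinite_UNIV_char_0)

lemma eventually_orbit_generic_parameter:
  "\<forall>\<^sub>F (c, z) in orbit_generic Z. c \<noteq> a"
  unfolding eventually_orbit_generic by (simp add: eventually_cofinite)

lemma eventually_orbit_generic_birational:
  assumes "birational_map X Y f" "eventually P (orbit_generic Y)"
  shows "\<forall>\<^sub>F (c, x) in orbit_generic X. \<exists>y. f x = Some y \<and> P (c, y)"
  unfolding eventually_orbit_generic
  using eventually_generic_birational[OF assms(1) assms(2)[unfolded eventually_orbit_generic]]
  by eventually_elim (auto elim: eventually_mono)

section \<open>Values of epsilon systems at generic points\<close>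

definition ival :: "(nat set \<Rightarrow> 'a \<rightharpoonup> complex) \<Rightarrow> 'a \<Rightarrow> nat \<Rightarrow> nat \<Rightarrow> complex" where
  "ival F x s t = the (with_empty F {s..<t} x)"

lemma ival_refl: "ival F x s s = 1"
  unfolding ival_def with_empty_def by simp

lemma ival_less: "s < t \<Longrightarrow> ival F x s t = the (F {s..<t} x)"
  unfolding ival_def with_empty_def by simp

definition gval :: "'a crystal \<Rightarrow> 'a \<Rightarrow> nat \<Rightarrow> complex" where
  "gval X x j = the (gam X j x)"

text \<open>All the pointwise facts about a single crystal that hold at its generic points.\<close>

definition regular_point :: "nat \<Rightarrow> 'a crystal \<Rightarrow> 'a eps_system \<Rightarrow> 'a \<Rightarrow> bool" where
  "regular_point n X E x \<longleftrightarrow>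
     (\<forall>J\<in>intervals n. x \<in> dom (eps E J) \<and> x \<in> dom (eps_star E J)) \<and>
     (\<forall>j\<in>{1..n}. gam X j x = Some (gval X x j) \<and> gval X x j \<noteq> 0 \<and>
        epsi X j x = Some (ival (eps E) x j (Suc j)) \<and> ival (eps E) x j (Suc j) \<noteq> 0) \<and>
     dual_arrays n (ival (eps E) x) (ival (eps_star E) x)"

lemma interval_in_intervals: "1 \<le> s \<Longrightarrow> s < t \<Longrightarrow> t \<le> Suc n \<Longrightarrow> {s..<t} \<in> intervals n"
proof -
  assume st: "1 \<le> s" "s < t" "t \<le> Suc n"
  then have "{s..<t} = {s..t - 1}" by auto
  then show ?thesis unfolding intervals_def using st by (intro CollectI exI[of _ s] exI[of _ "t - 1"]) auto
qed

lemma finite_intervals: "finite (intervals n)"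
  by (rule finite_subset[of _ "Pow {1..n}"]) (auto simp: intervals_def)

text \<open>Sending a point to its block is onto the partition.\<close>

lemma card_partition_le:
  assumes "partition_on A P" "finite A"
  shows "card P \<le> card A"
proof -
  have "P \<subseteq> (\<lambda>x. THE K. K \<in> P \<and> x \<in> K) ` A"
  proof
    fix K assume K: "K \<in> P"
    then obtain x where x: "x \<in> K" using partition_onD3[OF assms(1)] by fastforce
    have "(THE K. K \<in> P \<and> x \<in> K) = K"
      using K x partition_onD2[OF assms(1)] unfolding disjoint_def by (intro the_equality) auto
    moreover have "x \<in> A" using K x partition_onD1[OF assms(1)] by blast
    ultimately show "K \<in> (\<lambda>x. THE K. K \<in> P \<and> x \<in> K) ` A" by force
  qed
  then show ?thesis using assms(2) by (meson card_image_le card_mono finite_imageI le_trans)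
qed

lemma psum_interval_partitions:
  assumes "psum (\<lambda>P x. map_option (\<lambda>v. (- 1) ^ (card {s..<t} - card P) * v) (pprod F P x))
    (interval_partitions {s..<t}) x = Some v"
  shows "v = signed_partition_sum (\<lambda>K. the (F K x)) s t"
proof -
  let ?G = "\<lambda>P x. map_option (\<lambda>v. (- 1) ^ (card {s..<t} - card P) * v) (pprod F P x)"
  have dom: "x \<in> dom (?G P)" if "P \<in> interval_partitions {s..<t}" for P
    using assms that unfolding psum_def by (auto split: if_splits)
  have v: "v = (\<Sum>P\<in>interval_partitions {s..<t}. the (?G P x))"
    using assms unfolding psum_def by (auto split: if_splits)
  show ?thesis
    unfolding v signed_partition_sum_def
  proof (rule sum.cong[OF refl])
    fix P assume P: "P \<in> interval_partitions {s..<t}"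
    have "pprod F P x = Some (\<Prod>K\<in>P. the (F K x))"
      using dom[OF P] unfolding pprod_def by (auto split: if_splits)
    moreover have "card P \<le> t - s"
      using card_partition_le[of "{s..<t}" P] P unfolding interval_partitions_def by simp
    then have "t - s + card P = t - s - card P + 2 * card P" by simp
    then have "(- 1 :: complex) ^ (t - s + card P) = (- 1) ^ (t - s - card P)"
      by (simp only: power_add power_mult) simp
    ultimately show "the (?G P x) = (- 1) ^ (t - s + card P) * (\<Prod>K\<in>P. the (F K x))" by simp
  qed
qed

lemma dual_arrays_ival:
  assumes "\<And>s t. 1 \<le> s \<Longrightarrow> s < t \<Longrightarrow> t \<le> Suc n \<Longrightarrow>
    ival F' x s t = signed_partition_sum (\<lambda>K. the (F K x)) s t"
  shows "dual_arrays n (ival F x) (ival F' x)"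
  unfolding dual_arrays_def
proof (intro conjI allI impI ival_refl)
  fix s t assume st: "1 \<le> s \<and> s \<le> t \<and> t \<le> Suc n"
  have eq: "ival F' x k t = signed_partition_sum (\<lambda>K. the (F K x)) k t" if "s \<le> k" "k \<le> t" for k
    using assms[of k t] that st signed_partition_sum_refl by (cases "k = t") (auto simp: ival_refl)
  show "conv (alternate (ival F x)) (ival F' x) s t = delta s t"
  proof (cases "s = t")
    case True
    then show ?thesis by (simp add: conv_def alternate_def ival_refl delta_def)
  next
    case False
    then have lt: "s < t" using st by simp
    have "conv (alternate (ival F x)) (ival F' x) s t = signed_partition_sum (\<lambda>K. the (F K x)) s t +
        (\<Sum>k=Suc s..t. (- 1) ^ (k - s) * ival F x s k * ival F' x k t)"
      unfolding conv_def using st eq[of s] by (simp add: sum_split_first alternate_def ival_refl)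
    also have "(\<Sum>k=Suc s..t. (- 1) ^ (k - s) * ival F x s k * ival F' x k t) =
        (\<Sum>k\<in>{s<..t}. (- 1) ^ (k - s) * the (F {s..<k} x) * signed_partition_sum (\<lambda>K. the (F K x)) k t)"
      using eq by (intro sum.cong) (auto simp: ival_less)
    finally show ?thesis
      using lt signed_partition_sum_rec[OF lt, of "\<lambda>K. the (F K x)"] by (simp add: delta_def)
  qed
qed

lemma eventually_regular_point:
  assumes "geometric_crystal n X" "epsilon_system n X E"
    and "\<And>i. i \<in> {1..n} \<Longrightarrow> nonzero_on_components (pts X) (epsi X i) \<and>
           nonzero_on_components (pts X) (gam X i)"
  shows "\<forall>\<^sub>F x in generic (pts X). regular_point n X E x"
proof -
  have ind: "ind_variety (pts X)" using assms(1) unfolding geometric_crystal_def by blast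
  have E: "rational_function (pts X) (eps E J)" "rational_function (pts X) (eps_star E J)"
    if "J \<in> intervals n" for J
    using assms(2) that unfolding epsilon_system_def by blast+
  have dom: "\<forall>\<^sub>F x in generic (pts X). x \<in> dom f" if "rational_function (pts X) f" for f :: "'a \<rightharpoonup> complex"
    using that unfolding rational_function_def eventually_generic by blast
  have "\<forall>\<^sub>F x in generic (pts X). \<forall>J\<in>intervals n. x \<in> dom (eps E J)"
    "\<forall>\<^sub>F x in generic (pts X). \<forall>J\<in>intervals n. x \<in> dom (eps_star E J)"
    using E dom by (auto intro!: eventually_ball_finite[OF finite_intervals] simp del: domIff)
  moreover have "\<forall>\<^sub>F x in generic (pts X). \<forall>j\<in>{1..n}. \<exists>a. gam X j x = Some a \<and> a \<noteq> 0"
    "\<forall>\<^sub>F x in generic (pts X). \<forall>j\<in>{1..n}. \<exists>a. epsi X j x = Some a \<and> a \<noteq> 0"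
    using assms(1,3) unfolding geometric_crystal_def
    by (auto intro!: eventually_ball_finite eventually_generic_neq_0)
  moreover have "\<forall>\<^sub>F x in generic (pts X). \<forall>j\<in>{1..n}. \<exists>a. eps E {j} x = Some a \<and> epsi X j x = Some a"
    using assms(2) unfolding epsilon_system_def rat_eq_iff_generic
    by (auto intro!: eventually_ball_finite)
  moreover have "\<forall>\<^sub>F x in generic (pts X). \<forall>J\<in>intervals n. \<exists>v. eps_star E J x = Some v \<and>
      psum (\<lambda>P x. map_option (\<lambda>v. (- 1) ^ (card J - card P) * v) (pprod (eps E) P x))
           (interval_partitions J) x = Some v"
    using assms(2) unfolding epsilon_system_def rat_eq_iff_generic
    by (intro eventually_ball_finite[OF finite_intervals]) blast
  ultimately show ?thesis
  proof eventually_elim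
    case (elim x)
    have "dual_arrays n (ival (eps E) x) (ival (eps_star E) x)"
    proof (rule dual_arrays_ival)
      fix s t assume st: "1 \<le> s" "s < t" "t \<le> Suc n"
      then obtain v where "eps_star E {s..<t} x = Some v"
        "psum (\<lambda>P x. map_option (\<lambda>v. (- 1) ^ (card {s..<t} - card P) * v) (pprod (eps E) P x))
           (interval_partitions {s..<t}) x = Some v"
        using elim(6) interval_in_intervals[OF st] by blast
      then show "ival (eps_star E) x s t = signed_partition_sum (\<lambda>K. the (eps E K x)) s t"
        using psum_interval_partitions st by (simp add: ival_less)
    qed
    moreover have "gam X j x = Some (gval X x j) \<and> gval X x j \<noteq> 0 \<and>
        epsi X j x = Some (ival (eps E) x j (Suc j)) \<and> ival (eps E) x j (Suc j) \<noteq> 0"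
      if "j \<in> {1..n}" for j
    proof -
      have "{j..<Suc j} = {j}" by auto
      then show ?thesis using elim(3-5) that by (fastforce simp: gval_def ival_less)
    qed
    ultimately show ?case using elim(1,2) unfolding regular_point_def by blast
  qed
qed

definition moved_point :: "nat \<Rightarrow> 'a crystal \<Rightarrow> 'a eps_system \<Rightarrow> nat \<Rightarrow> complex \<Rightarrow> 'a \<Rightarrow> 'a \<Rightarrow> bool" where
  "moved_point n X E i c x x' \<longleftrightarrow>
     arrays_moved n i c (ival (eps E) x) (ival (eps_star E) x) (ival (eps E) x') (ival (eps_star E) x') \<and>
     weights_moved n i c (gval X x) (gval X x')"

text \<open>The clauses of the definitions, which concern one index or one interval each, hold simultaneously because there are
  finitely many of them.\<close>

lemma eventually_moved_point:
  assumes "geometric_crystal n X" "epsilon_system n X E" "i \<in> {1..n}"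
  shows "\<forall>\<^sub>F (c, x) in orbit_generic (pts X). \<forall>x'. act X i c x = Some x' \<longrightarrow> moved_point n X E i c x x'"
proof -
  have ind: "ind_variety (pts X)" using assms(1) unfolding geometric_crystal_def by blast
  note slice = rat_eq_orbit_generic[OF ind, of "\<lambda>c. _ \<circ>\<^sub>m act X i c"]
  let ?gam = "\<lambda>(c, x). \<forall>j\<in>{1..n}. \<exists>y. (gam X j \<circ>\<^sub>m act X i c) x = Some y \<and>
      map_option (\<lambda>v. c powi cartan i j * v) (gam X j x) = Some y"
  have "eventually ?gam (orbit_generic (pts X))"
    using assms(1,3) unfolding geometric_crystal_def case_prod_beta'
    by (intro eventually_ball_finite ballI slice[unfolded case_prod_beta']) auto
  moreover
  have mv: "\<forall>\<^sub>F (c, x) in orbit_generic (pts X). \<forall>s\<in>{1..n}. \<forall>t\<in>{s..n}.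
      D s t \<longrightarrow> (\<exists>y. (f {s..t} \<circ>\<^sub>m act X i c) x = Some y \<and> f' c {s..t} x = Some y)"
    if "\<And>s t. 1 \<le> s \<Longrightarrow> s \<le> t \<Longrightarrow> t \<le> n \<Longrightarrow> D s t \<Longrightarrow> rat_eq (Gm_ind \<times>\<^sub>I pts X)
           (\<lambda>(c, x). (f {s..t} \<circ>\<^sub>m act X i c) x) (\<lambda>(c, x). f' c {s..t} x)"
    for D and f :: "nat set \<Rightarrow> 'a \<rightharpoonup> complex" and f'
  proof -
    have "\<forall>\<^sub>F p in orbit_generic (pts X). D s t \<longrightarrow> (\<exists>y. (f {s..t} \<circ>\<^sub>m act X i (fst p)) (snd p) = Some y \<and>
        f' (fst p) {s..t} (snd p) = Some y)" if "s \<in> {1..n}" "t \<in> {s..n}" for s t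
      using rat_eq_orbit_generic[OF ind, of "\<lambda>c. f {s..t} \<circ>\<^sub>m act X i c" "\<lambda>c. f' c {s..t}"]
        \<open>\<And>s t. 1 \<le> s \<Longrightarrow> s \<le> t \<Longrightarrow> t \<le> n \<Longrightarrow> D s t \<Longrightarrow> _ s t\<close>[of s t] that
      by (cases "D s t") (auto simp: case_prod_beta')
    then show ?thesis
      unfolding case_prod_beta' by (intro eventually_ball_finite ballI) auto
  qed
  note E = assms(2)[unfolded epsilon_system_def, THEN conjunct2, THEN conjunct2, THEN conjunct1, rule_format]
  have "\<forall>\<^sub>F (c, x) in orbit_generic (pts X). \<forall>s\<in>{1..n}. \<forall>t\<in>{s..n}. i = s \<longrightarrow>
      (\<exists>y. (eps E {s..t} \<circ>\<^sub>m act X i c) x = Some y \<and>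
        map_option (\<lambda>v. inverse c * v) (eps E {s..t} x) = Some y)"
    by (rule mv) (use E[of _ _ i] assms(3) in blast)
  moreover have "\<forall>\<^sub>F (c, x) in orbit_generic (pts X). \<forall>s\<in>{1..n}. \<forall>t\<in>{s..n}. i \<notin> {s - 1, s, t + 1} \<longrightarrow>
      (\<exists>y. (eps E {s..t} \<circ>\<^sub>m act X i c) x = Some y \<and> eps E {s..t} x = Some y)"
    by (rule mv) (use E[of _ _ i] assms(3) in blast)
  moreover have "\<forall>\<^sub>F (c, x) in orbit_generic (pts X). \<forall>s\<in>{1..n}. \<forall>t\<in>{s..n}. i = t \<longrightarrow>
      (\<exists>y. (eps_star E {s..t} \<circ>\<^sub>m act X i c) x = Some y \<and>
        map_option (\<lambda>v. inverse c * v) (eps_star E {s..t} x) = Some y)"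
    by (rule mv) (use E[of _ _ i] assms(3) in blast)
  moreover have "\<forall>\<^sub>F (c, x) in orbit_generic (pts X). \<forall>s\<in>{1..n}. \<forall>t\<in>{s..n}. i \<notin> {s - 1, t, t + 1} \<longrightarrow>
      (\<exists>y. (eps_star E {s..t} \<circ>\<^sub>m act X i c) x = Some y \<and> eps_star E {s..t} x = Some y)"
    by (rule mv) (use E[of _ _ i] assms(3) in blast)
  ultimately show ?thesis
  proof eventually_elim
    case (elim p)
    obtain c x where p: "p = (c, x)" by (cases p)
    have "moved_point n X E i c x x'" if x': "act X i c x = Some x'" for x'
      unfolding moved_point_def
    proof
      show "weights_moved n i c (gval X x) (gval X x')"
        unfolding weights_moved_def
      proof
        fix j assume "j \<in> {1..n}"
        then have "\<exists>y. (gam X j \<circ>\<^sub>m act X i c) x = Some y \<and>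
            map_option (\<lambda>v. c powi cartan i j * v) (gam X j x) = Some y"
          using elim(1) unfolding p by blast
        then obtain y where "gam X j x' = Some y"
          "map_option (\<lambda>v. c powi cartan i j * v) (gam X j x) = Some y"
          using x' by auto
        then show "gval X x' j = c powi cartan i j * gval X x j" unfolding gval_def by auto
      qed
      show "arrays_moved n i c (ival (eps E) x) (ival (eps_star E) x)
          (ival (eps E) x') (ival (eps_star E) x')"
        unfolding arrays_moved_def
      proof (intro allI impI)
        fix s t assume st: "1 \<le> s \<and> s < t \<and> t \<le> Suc n"
        define r where "r = t - 1"
        have r: "t = Suc r" "s \<in> {1..n}" "r \<in> {s..n}" using st unfolding r_def by auto
        have ivl: "{s..<t} = {s..r}" unfolding r by auto
        have val: "ival F z s t = the (F {s..r} z)" for F :: "nat set \<Rightarrow> 'a \<rightharpoonup> complex" and z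
          using st by (simp add: ival_less ivl)
        note el = elim(2-5)[unfolded p prod.case, rule_format, OF r(2,3)]
        show "(i = s \<longrightarrow> ival (eps E) x' s t = ival (eps E) x s t / c) \<and>
          (i \<notin> {s - 1, s, t} \<longrightarrow> ival (eps E) x' s t = ival (eps E) x s t) \<and>
          (Suc i = t \<longrightarrow> ival (eps_star E) x' s t = ival (eps_star E) x s t / c) \<and>
          (i \<notin> {s - 1, t - 1, t} \<longrightarrow> ival (eps_star E) x' s t = ival (eps_star E) x s t)"
          unfolding val using el x' r(1) by (auto simp: divide_inverse)
      qed
    qed
    then show ?case unfolding p by simp
  qed
qed

text \<open>Regularity of the image point is what makes duality of the arrays available there.\<close>

lemma eventually_moved_regular_point:
  assumes "geometric_crystal n X" "epsilon_system n X E" "i \<in> {1..n}"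
    and "\<forall>\<^sub>F x in generic (pts X). regular_point n X E x"
  shows "\<forall>\<^sub>F (c, x) in orbit_generic (pts X).
    \<exists>x'. act X i c x = Some x' \<and> regular_point n X E x' \<and> moved_point n X E i c x x'"
proof -
  have "\<forall>\<^sub>F p in orbit_generic (pts X). \<exists>x'. act X i (fst p) (snd p) = Some x' \<and> regular_point n X E x'"
    unfolding eventually_orbit_generic fst_conv snd_conv
    using assms by (intro eventually_generic_act) (auto simp: geometric_crystal_def)
  with eventually_moved_point[OF assms(1-3)] show ?thesis
    by eventually_elim auto
qed

section \<open>The product epsilon system at generic points\<close>

definition pval where
  "pval X Y E F z = prod_array (gval X (fst z)) (ival (eps E) (fst z)) (ival (eps F) (snd z))"

definition pval_star where
  "pval_star X Y E F z =
     prod_array_star (gval X (fst z)) (ival (eps_star E) (fst z)) (ival (eps_star F) (snd z))"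

lemma regular_point_interval:
  assumes "regular_point n X E x" "1 \<le> s" "s \<le> t" "t \<le> Suc n"
  shows "with_empty (eps E) {s..<t} x = Some (ival (eps E) x s t)"
    and "with_empty (eps_star E) {s..<t} x = Some (ival (eps_star E) x s t)"
    and "pprod (gam X) {s..<t} x = Some (prod (gval X x) {s..<t})"
    and "prod (gval X x) {s..<t} \<noteq> 0"
proof -
  have "{s..<t} \<in> intervals n" if "s < t" using interval_in_intervals that assms by blast
  then show "with_empty (eps E) {s..<t} x = Some (ival (eps E) x s t)"
    "with_empty (eps_star E) {s..<t} x = Some (ival (eps_star E) x s t)"
    using assms(1,3) unfolding regular_point_def
    by (cases "s = t"; fastforce simp: ival_def with_empty_def)+
  have "gam X j x = Some (gval X x j) \<and> gval X x j \<noteq> 0" if "j \<in> {s..<t}" for j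
    using assms that unfolding regular_point_def by auto
  then show "pprod (gam X) {s..<t} x = Some (prod (gval X x) {s..<t})"
    "prod (gval X x) {s..<t} \<noteq> 0"
    unfolding pprod_def by (auto intro!: prod.cong)
qed

lemma psum_Some: "(\<And>k. k \<in> A \<Longrightarrow> F k x = Some (f k)) \<Longrightarrow> psum F A x = Some (sum f A)"
  unfolding psum_def by (auto intro!: sum.cong)

lemma eps_system_prod_interval:
  assumes x: "regular_point n X E x" and y: "regular_point n Y F y"
    and st: "1 \<le> s" "s < t" "t \<le> Suc n"
  shows "eps (eps_system_prod X Y E F) {s..<t} (x, y) = Some (pval X Y E F (x, y) s t)"
    and "eps_star (eps_system_prod X Y E F) {s..<t} (x, y) = Some (pval_star X Y E F (x, y) s t)"
proof -
  obtain r where r: "t = Suc r" using st by (cases t) auto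
  obtain q where q: "s = Suc q" using st by (cases s) auto
  have mm: "Min {s..<t} = s" "Max {s..<t} = r"
    using st r by (auto intro!: Min_eqI Max_eqI)
  have ivl: "{s..k} = {s..<Suc k}" "{k + 1..r} = {Suc k..<t}" for k unfolding r by auto
  have shift: "(\<Sum>k=s - 1..r. f (Suc k)) = (\<Sum>k=s..t. f k)" for f :: "nat \<Rightarrow> complex"
    unfolding r q by (simp only: sum.shift_bounds_cl_Suc_ivl diff_Suc_1)
  show "eps (eps_system_prod X Y E F) {s..<t} (x, y) = Some (pval X Y E F (x, y) s t)"
    unfolding eps_system_prod_def pval_def prod_array_def
    unfolding eps_system.simps Let_def mm shift[symmetric]
  proof (rule psum_Some)
    fix k assume "k \<in> {s - 1..r}"
    then have k: "s \<le> Suc k" "Suc k \<le> t" "1 \<le> Suc k" "Suc k \<le> Suc n" using st r by auto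
    show "(case (x, y) of (x, y) \<Rightarrow>
        do { b \<leftarrow> with_empty (eps F) {s..k} y;
             a \<leftarrow> with_empty (eps E) {k+1..r} x;
             g \<leftarrow> pprod (gam X) {s..k} x;
             odiv (b * a) g }) = Some (ival (eps F) (snd (x, y)) s (Suc k) *
          ival (eps E) (fst (x, y)) (Suc k) t / prod (gval X (fst (x, y))) {s..<Suc k})"
      unfolding ivl
      using regular_point_interval[OF y st(1) k(1,4)] regular_point_interval[OF x st(1) k(1,4)]
        regular_point_interval[OF x k(3,2) st(3)]
      by (simp add: odiv_def)
  qed
  show "eps_star (eps_system_prod X Y E F) {s..<t} (x, y) = Some (pval_star X Y E F (x, y) s t)"
    unfolding eps_system_prod_def pval_star_def prod_array_star_def
    unfolding eps_system.simps Let_def mm shift[symmetric]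
  proof (rule psum_Some)
    fix k assume "k \<in> {s - 1..r}"
    then have k: "s \<le> Suc k" "Suc k \<le> t" "1 \<le> Suc k" "Suc k \<le> Suc n" using st r by auto
    show "(case (x, y) of (x, y) \<Rightarrow>
        do { a \<leftarrow> with_empty (eps_star E) {s..k} x;
             b \<leftarrow> with_empty (eps_star F) {k+1..r} y;
             g \<leftarrow> pprod (gam X) {k+1..r} x;
             odiv (a * b) g }) = Some (ival (eps_star E) (fst (x, y)) s (Suc k) *
          ival (eps_star F) (snd (x, y)) (Suc k) t / prod (gval X (fst (x, y))) {Suc k..<t})"
      unfolding ivl
      using regular_point_interval[OF x st(1) k(1,4)] regular_point_interval[OF y k(3,2) st(3)]
        regular_point_interval[OF x k(3,2) st(3)]
      by (simp add: odiv_def)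
  qed
qed

lemma pval_dual:
  assumes "regular_point n X E x" "regular_point n Y F y"
  shows "dual_arrays n (pval X Y E F (x, y)) (pval_star X Y E F (x, y))"
  using assms unfolding regular_point_def pval_def pval_star_def fst_conv snd_conv
  by (intro dual_arrays_prod) auto

lemma pval_adjacent:
  assumes x: "regular_point n X E x" and y: "regular_point n Y F y" and s: "s \<in> {1..n}"
  shows "epsi (crystal_prod X Y) s (x, y) = Some (pval X Y E F (x, y) s (Suc s))"
proof -
  have "gam X s x = Some (gval X x s)" "gval X x s \<noteq> 0"
    "epsi X s x = Some (ival (eps E) x s (Suc s))" "epsi Y s y = Some (ival (eps F) y s (Suc s))"
    using assms unfolding regular_point_def by auto
  then show ?thesis
    by (simp add: crystal_prod_def odiv_def pval_def prod_array_def ival_refl)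
qed

text \<open>The set \<open>D\<close> serves to remove the poles of \<open>f\<close>, where its default value could destroy injectivity.\<close>

lemma eventually_cofinite_inj_on:
  assumes "eventually P cofinite" "inj_on f D" "\<forall>\<^sub>F x in cofinite. x \<in> D"
  shows "\<forall>\<^sub>F x in cofinite. P (f x)"
proof -
  have "finite (f -` {y. \<not> P y} \<inter> D)"
    using assms(1,2) by (intro finite_vimage_IntI) (simp_all add: eventually_cofinite)
  moreover have "finite {x. x \<notin> D}" using assms(3) by (simp add: eventually_cofinite)
  ultimately show ?thesis
    unfolding eventually_cofinite by (rule rev_finite_subset[OF finite_UnI]) auto
qed

text \<open>The factors are moved by the parameters \<open>c\<^sub>1\<close> and \<open>c\<^sub>2\<close>.  For fixed \<open>(x, y)\<close> these are Moebius functions of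
  \<open>c\<close>; they are not constant because \<open>\<gamma>\<^sub>s\<close>, \<open>\<epsilon>\<^sub>s\<close> at \<open>x\<close> and \<open>\<epsilon>\<^sub>s\<close> at \<open>y\<close> are nonzero.  So what holds on each factor
  for almost all parameters still holds for almost all \<open>c\<close> after substitution.\<close>

lemma eventually_product_moved:
  assumes X: "geometric_crystal n X" "epsilon_system n X E"
    "\<forall>\<^sub>F x in generic (pts X). regular_point n X E x"
    and Y: "geometric_crystal n Y" "epsilon_system n Y F"
    "\<forall>\<^sub>F y in generic (pts Y). regular_point n Y F y"
    and XY: "geometric_crystal n (crystal_prod X Y)" and s: "s \<in> {1..n}"
  shows "\<forall>\<^sub>F (c, z) in orbit_generic (pts X \<times>\<^sub>I pts Y). \<forall>z' t.
      act (crystal_prod X Y) s c z = Some z' \<and> Suc s < t \<and> t \<le> Suc n \<longrightarrow>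
        pval X Y E F z' s t = pval X Y E F z s t / c \<and>
        pval_star X Y E F z' s t = pval_star X Y E F z s t"
proof -
  have ind: "ind_variety (pts X)" "ind_variety (pts Y)"
    using X(1) Y(1) unfolding geometric_crystal_def by auto
  have "\<forall>\<^sub>F (x, y) in generic (pts X \<times>\<^sub>I pts Y). \<forall>\<^sub>F c in cofinite.
    \<exists>x'. act X s c x = Some x' \<and> regular_point n X E x' \<and> moved_point n X E s c x x'"
    using eventually_moved_regular_point[OF X(1,2) s X(3)] unfolding eventually_orbit_generic
    by (intro eventually_generic_fst[OF ind]) simp
  moreover have "\<forall>\<^sub>F (x, y) in generic (pts X \<times>\<^sub>I pts Y). \<forall>\<^sub>F c in cofinite.
    \<exists>y'. act Y s c y = Some y' \<and> regular_point n Y F y' \<and> moved_point n Y F s c y y'"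
    using eventually_moved_regular_point[OF Y(1,2) s Y(3)] unfolding eventually_orbit_generic
    by (intro eventually_generic_snd[OF ind]) simp
  moreover have "\<forall>\<^sub>F (x, y) in generic (pts X \<times>\<^sub>I pts Y). regular_point n X E x"
    by (rule eventually_generic_fst[OF ind X(3)])
  moreover have "\<forall>\<^sub>F (x, y) in generic (pts X \<times>\<^sub>I pts Y). regular_point n Y F y"
    by (rule eventually_generic_snd[OF ind Y(3)])
  moreover have "\<forall>\<^sub>F z in generic (pts X \<times>\<^sub>I pts Y). \<forall>\<^sub>F c in cofinite.
      \<exists>z'. act (crystal_prod X Y) s c z = Some z' \<and> True"
    using XY s unfolding geometric_crystal_def
    by (intro eventually_generic_act) (auto simp: crystal_prod_def)
  ultimately show ?thesis
    unfolding eventually_orbit_generic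
  proof eventually_elim
    case (elim z)
    obtain x y where z: "z = (x, y)" by (cases z)
    define g where "g = gval X x s"
    define a where "a = ival (eps E) x s (Suc s)"
    define b where "b = ival (eps F) y s (Suc s)"
    have x: "regular_point n X E x" and y: "regular_point n Y F y" using elim unfolding z by auto
    have val: "gam X s x = Some g" "epsi X s x = Some a" "epsi Y s y = Some b"
      and ne: "g \<noteq> 0" "a \<noteq> 0" "b \<noteq> 0"
      using x y s unfolding regular_point_def g_def a_def b_def by auto
    let ?k = "g * a + b"
    have act: "act (crystal_prod X Y) s c (x, y) =
        do { c1 \<leftarrow> odiv (c * g * a + b) ?k; c2 \<leftarrow> odiv c c1;
             x' \<leftarrow> act X s c1 x; y' \<leftarrow> act Y s c2 y; Some (x', y') }" for c
      by (simp add: crystal_prod_def val)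
    \<comment> \<open>Otherwise no operator with index \<open>s\<close> would be defined at \<open>z\<close>.\<close>
    have k: "?k \<noteq> 0"
    proof
      assume "?k = 0"
      then have "\<forall>\<^sub>F c in cofinite. act (crystal_prod X Y) s c z = None"
        unfolding z act odiv_def by simp
      with elim(5) have "\<forall>\<^sub>F c in (cofinite :: complex filter). False"
        by eventually_elim simp
      then show False by (simp add: eventually_cofinite infinite_UNIV_char_0)
    qed
    let ?c1 = "\<lambda>c. (c * g * a + b) / ?k" and ?c2 = "\<lambda>c. c / ((c * g * a + b) / ?k)"
    have "inj_on (\<lambda>c. c * g * a + b) UNIV" using ne by (auto simp: inj_on_def)
    then have c1: "\<forall>\<^sub>F c in cofinite. c * g * a + b \<noteq> 0"
      using eventually_cofinite_inj_on[where P = "\<lambda>c. c \<noteq> 0" and f = "\<lambda>c. c * g * a + b" and D = UNIV]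
      by (simp add: eventually_cofinite)
    have "inj_on ?c1 UNIV" using ne k by (auto simp: inj_on_def)
    then have ev1: "\<forall>\<^sub>F c in cofinite. \<exists>x'. act X s (?c1 c) x = Some x' \<and>
        regular_point n X E x' \<and> moved_point n X E s (?c1 c) x x'"
      by (rule eventually_cofinite_inj_on[OF elim(1)[unfolded z prod.case]]) simp
    have "inj_on ?c2 {c. c * g * a + b \<noteq> 0}"
    proof (rule inj_onI)
      fix c d assume "c \<in> {c. c * g * a + b \<noteq> 0}" "d \<in> {c. c * g * a + b \<noteq> 0}" "?c2 c = ?c2 d"
      then have "c * (d * g * a + b) = d * (c * g * a + b)"
        using k by (simp add: divide_simps)
      then show "c = d" using ne by (simp add: algebra_simps)
    qed
    then have ev2: "\<forall>\<^sub>F c in cofinite. \<exists>y'. act Y s (?c2 c) y = Some y' \<and>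
        regular_point n Y F y' \<and> moved_point n Y F s (?c2 c) y y'"
      by (rule eventually_cofinite_inj_on[OF elim(2)[unfolded z prod.case]]) (simp add: c1)
    have c0: "\<forall>\<^sub>F c in cofinite. c \<noteq> (0::complex)" by (simp add: eventually_cofinite)
    from c1 ev1 ev2 c0 show ?case
      unfolding prod.case
    proof eventually_elim
      case (elim c)
      obtain x' where x': "act X s (?c1 c) x = Some x'" "regular_point n X E x'"
        "moved_point n X E s (?c1 c) x x'" using elim(2) by blast
      obtain y' where y': "act Y s (?c2 c) y = Some y'" "regular_point n Y F y'"
        "moved_point n Y F s (?c2 c) y y'" using elim(3) by blast
      have c1_ne: "?c1 c \<noteq> 0" using elim(1) k by simp
      have act_c: "act (crystal_prod X Y) s c (x, y) = Some (x', y')"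
        unfolding act odiv_def using k c1_ne x'(1) y'(1) by simp
      have dx: "dual_arrays n (ival (eps E) x) (ival (eps_star E) x)"
        "dual_arrays n (ival (eps E) x') (ival (eps_star E) x')"
        using x x'(2) unfolding regular_point_def by auto
      have dy: "dual_arrays n (ival (eps F) y) (ival (eps_star F) y)"
        "dual_arrays n (ival (eps F) y') (ival (eps_star F) y')"
        using y y'(2) unfolding regular_point_def by auto
      have mx: "arrays_moved n s (?c1 c) (ival (eps E) x) (ival (eps_star E) x)
          (ival (eps E) x') (ival (eps_star E) x')" "weights_moved n s (?c1 c) (gval X x) (gval X x')"
        using x'(3) unfolding moved_point_def by auto
      have my: "arrays_moved n s (?c2 c) (ival (eps F) y) (ival (eps_star F) y)
          (ival (eps F) y') (ival (eps_star F) y')"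
        using y'(3) unfolding moved_point_def by auto
      have gne: "gval X x j \<noteq> 0" if "j \<in> {1..n}" for j
        using x that unfolding regular_point_def by auto
      have c1_eq: "?c1 c * (gval X x s * ival (eps E) x s (Suc s) + ival (eps F) y s (Suc s)) =
          c * gval X x s * ival (eps E) x s (Suc s) + ival (eps F) y s (Suc s)"
        using k unfolding g_def a_def b_def by simp
      note moved = prod_arrays_moved[OF dx mx(1) dy my mx(2) gne _ _ _
          ne(2)[unfolded a_def] ne(3)[unfolded b_def] elim(4) c1_ne refl c1_eq]
      show ?case
        unfolding z act_c pval_def pval_star_def
        using moved s by auto
    qed
  qed
qed

section \<open>Comparison along the tropical R map\<close>

text \<open>In the recursion for \<open>\<epsilon>\<^sup>*\<^sub>J\<close> all terms except \<open>\<plusminus>\<epsilon>\<^sub>J\<close> involve proper subintervals of \<open>J\<close> only.\<close>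

lemma dual_arrays_difference:
  assumes "dual_arrays n e e'" "dual_arrays n f f'" "1 \<le> s" "s < t" "t \<le> Suc n"
    and "\<And>k. s < k \<Longrightarrow> k < t \<Longrightarrow> e s k = f s k \<and> e' k t = f' k t"
  shows "e' s t - f' s t = - ((- 1) ^ (t - s)) * (e s t - f s t)"
proof -
  obtain r where r: "t = Suc r" "s \<le> r" using assms(4) by (cases t) auto
  have expand: "g' s t + (\<Sum>k=Suc s..r. alternate g s k * g' k t) + (- 1) ^ (t - s) * g s t = 0"
    if "dual_arrays n g g'" for g g'
  proof -
    have "conv (alternate g) g' s t = 0" "g s s = 1" "g' t t = 1"
      using that assms(3-5) unfolding dual_arrays_def delta_def by auto
    then show ?thesis
      unfolding conv_def r(1) using r(2)
      by (simp add: sum_split_first alternate_def algebra_simps)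
  qed
  have "(\<Sum>k=Suc s..r. alternate e s k * e' k t) = (\<Sum>k=Suc s..r. alternate f s k * f' k t)"
    using assms(6) r by (intro sum.cong) (auto simp: alternate_def)
  then have "(e' s t + (\<Sum>k=Suc s..r. alternate e s k * e' k t) + (- 1) ^ (t - s) * e s t) -
      (f' s t + (\<Sum>k=Suc s..r. alternate f s k * f' k t) + (- 1) ^ (t - s) * f s t) =
      (e' s t - f' s t) - - ((- 1) ^ (t - s)) * (e s t - f s t)"
    by (simp add: algebra_simps)
  then show ?thesis unfolding expand[OF assms(1)] expand[OF assms(2)] by (simp add: eq_neg_iff_add_eq_0)
qed

text \<open>The induction on the length of the interval.  Its core is the last case: the relation \<open>?K\<close> between the
  two differences holds generically, hence also at almost all points of the orbit of a generic \<open>z\<close>.  There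
  the left-hand side is unchanged and the right-hand side has been divided by \<open>c\<close>.\<close>

lemma eventually_pval_birational_eq:
  assumes X: "geometric_crystal n X" "epsilon_system n X E"
    "\<forall>\<^sub>F x in generic (pts X). regular_point n X E x"
    and Y: "geometric_crystal n Y" "epsilon_system n Y F"
    "\<forall>\<^sub>F y in generic (pts Y). regular_point n Y F y"
    and XY: "geometric_crystal n (crystal_prod X Y)" and YX: "geometric_crystal n (crystal_prod Y X)"
    and R: "birational_map (pts X \<times>\<^sub>I pts Y) (pts Y \<times>\<^sub>I pts X) R"
    and R_act: "\<And>i. i \<in> {1..n} \<Longrightarrow> rat_eq (Gm_ind \<times>\<^sub>I pts X \<times>\<^sub>I pts Y)
          (\<lambda>(c, z). (act (crystal_prod Y X) i c \<circ>\<^sub>m R) z)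
          (\<lambda>(c, z). (R \<circ>\<^sub>m act (crystal_prod X Y) i c) z)"
    and R_epsi: "\<And>i. i \<in> {1..n} \<Longrightarrow> rat_eq (pts X \<times>\<^sub>I pts Y)
          (epsi (crystal_prod X Y) i) (epsi (crystal_prod Y X) i \<circ>\<^sub>m R)"
    and reg: "\<forall>\<^sub>F z in generic (pts X \<times>\<^sub>I pts Y). regular_point n X E (fst z) \<and> regular_point n Y F (snd z) \<and>
        (\<exists>w. R z = Some w \<and> regular_point n Y F (fst w) \<and> regular_point n X E (snd w))"
    and st: "1 \<le> s" "s \<le> t" "t \<le> Suc n"
  shows "\<forall>\<^sub>F z in generic (pts X \<times>\<^sub>I pts Y). \<forall>w. R z = Some w \<longrightarrow>
      pval X Y E F z s t = pval Y X F E w s t \<and> pval_star X Y E F z s t = pval_star Y X F E w s t"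
  using st
proof (induction "t - s" arbitrary: s t rule: less_induct)
  case less
  let ?Z = "pts X \<times>\<^sub>I pts Y"
  let ?A = "pval X Y E F" and ?A' = "pval_star X Y E F"
  let ?B = "pval Y X F E" and ?B' = "pval_star Y X F E"
  have dual: "dual_arrays n (?A z) (?A' z)" if "regular_point n X E (fst z)" "regular_point n Y F (snd z)" for z
    using pval_dual[OF that] by simp
  have dual': "dual_arrays n (?B w) (?B' w)" if "regular_point n Y F (fst w)" "regular_point n X E (snd w)" for w
    using pval_dual[OF that] by simp
  consider "s = t" | "t = Suc s" | "Suc s < t" using less.prems by linarith
  then show ?case
  proof cases
    case 1
    have "?A z s s = 1" "?A' z s s = 1" "?B w s s = 1" "?B' w s s = 1" for z w
      by (simp_all add: pval_def pval_star_def prod_array_def prod_array_star_def ival_refl)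
    then show ?thesis using 1 by simp
  next
    case 2
    have s: "s \<in> {1..n}" "1 \<le> s" "s \<le> n" using 2 less.prems by auto
    from reg R_epsi[OF s(1), unfolded rat_eq_iff_generic] show ?thesis
    proof eventually_elim
      case (elim z)
      show ?case
      proof (intro allI impI)
        fix w assume w: "R z = Some w"
        have z: "regular_point n X E (fst z)" "regular_point n Y F (snd z)" using elim by auto
        have w': "regular_point n Y F (fst w)" "regular_point n X E (snd w)" using elim w by auto
        have "?A z s (Suc s) = ?B w s (Suc s)"
          using elim(2) w pval_adjacent[OF z s(1)] pval_adjacent[OF w' s(1)] by simp
        then show "?A z s t = ?B w s t \<and> ?A' z s t = ?B' w s t"
          unfolding 2 using dual_arrays_adjacent[OF dual[OF z] s(2,3)]
            dual_arrays_adjacent[OF dual'[OF w'] s(2,3)] by simp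
      qed
    qed
  next
    case 3
    have s: "s \<in> {1..n}" using 3 less.prems by auto
    define \<sigma> :: complex where "\<sigma> = - ((- 1) ^ (t - s))"
    let ?K = "\<lambda>z. \<forall>w. R z = Some w \<longrightarrow> ?A' z s t - ?B' w s t = \<sigma> * (?A z s t - ?B w s t)"
    have "\<forall>\<^sub>F z in generic ?Z. \<forall>k\<in>{s<..<t}. (\<forall>w. R z = Some w \<longrightarrow> ?A z s k = ?B w s k \<and> ?A' z s k = ?B' w s k) \<and>
        (\<forall>w. R z = Some w \<longrightarrow> ?A z k t = ?B w k t \<and> ?A' z k t = ?B' w k t)"
      using less.prems by (intro eventually_ball_finite ballI eventually_conj less.hyps) auto
    with reg have K: "\<forall>\<^sub>F z in generic ?Z. ?K z"
    proof eventually_elim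
      case (elim z)
      show ?case
      proof (intro allI impI)
        fix w assume w: "R z = Some w"
        have z: "regular_point n X E (fst z)" "regular_point n Y F (snd z)" using elim by auto
        have w': "regular_point n Y F (fst w)" "regular_point n X E (snd w)" using elim w by auto
        show "?A' z s t - ?B' w s t = \<sigma> * (?A z s t - ?B w s t)"
          unfolding \<sigma>_def
          by (rule dual_arrays_difference[OF dual[OF z] dual'[OF w']]) (use elim(2) w less.prems 3 in auto)
      qed
    qed
    have ind: "ind_variety ?Z"
      using XY unfolding geometric_crystal_def by (simp add: crystal_prod_def)
    have "\<forall>\<^sub>F z in generic ?Z. \<forall>\<^sub>F c in cofinite. \<exists>z'. act (crystal_prod X Y) s c z = Some z' \<and> ?K z'"
      using XY s K unfolding geometric_crystal_def
      by (intro eventually_generic_act) (auto simp: crystal_prod_def)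
    then have "\<forall>\<^sub>F p in orbit_generic ?Z. \<exists>z'. act (crystal_prod X Y) s (fst p) (snd p) = Some z' \<and> ?K z'"
      unfolding eventually_orbit_generic by simp
    moreover note eventually_orbit_generic_point[OF K]
    moreover note eventually_product_moved[OF X Y XY s]
    moreover note eventually_orbit_generic_birational[OF R eventually_product_moved[OF Y X YX s]]
    moreover note rat_eq_orbit_generic[OF ind R_act[OF s]]
    moreover note eventually_orbit_generic_parameter[of 0 ?Z] eventually_orbit_generic_parameter[of 1 ?Z]
    ultimately have "\<forall>\<^sub>F p in orbit_generic ?Z. \<forall>w. R (snd p) = Some w \<longrightarrow>
        ?A (snd p) s t = ?B w s t \<and> ?A' (snd p) s t = ?B' w s t"
    proof eventually_elim
      case (elim p)
      obtain c z where p: "p = (c, z)" by (cases p)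
      note el = elim[unfolded p prod.case fst_conv snd_conv]
      obtain z' where z': "act (crystal_prod X Y) s c z = Some z'" "?K z'" using el(1) by blast
      obtain w where w: "R z = Some w"
        "\<And>w'. act (crystal_prod Y X) s c w = Some w' \<Longrightarrow>
          ?B w' s t = ?B w s t / c \<and> ?B' w' s t = ?B' w s t"
        using el(4) 3 less.prems(3) by blast
      obtain w' where w': "act (crystal_prod Y X) s c w = Some w'" "R z' = Some w'"
        using el(5) w(1) z'(1) by auto
      have "?A z' s t = ?A z s t / c" "?A' z' s t = ?A' z s t"
        using el(3) z'(1) 3 less.prems(3) by blast+
      moreover have "?B w' s t = ?B w s t / c" "?B' w' s t = ?B' w s t"
        using w(2)[OF w'(1)] by auto
      moreover have K: "?A' z s t - ?B' w s t = \<sigma> * (?A z s t - ?B w s t)" using el(2) w(1) by blast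
      moreover have "?A' z' s t - ?B' w' s t = \<sigma> * (?A z' s t - ?B w' s t)" using z'(2) w'(2) by blast
      ultimately have "\<sigma> * (?A z s t - ?B w s t) = \<sigma> * (?A z s t / c - ?B w s t / c)" by simp
      moreover have "\<sigma> \<noteq> 0" unfolding \<sigma>_def by simp
      ultimately have "?A z s t - ?B w s t = ?A z s t / c - ?B w s t / c"
        by (metis mult_cancel_left)
      then have "?A z s t - ?B w s t = (?A z s t - ?B w s t) / c"
        unfolding diff_divide_distrib .
      then have "(?A z s t - ?B w s t) * (c - 1) = 0" using el(6) by (simp add: field_simps)
      then have "?A z s t = ?B w s t" using el(7) by simp
      then show ?case unfolding p using K w(1) by simp
    qed
    then show ?thesis
      by (intro eventually_generic_of_orbit) (simp add: case_prod_beta')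
  qed
qed

theorem theorem7p1:
  fixes n :: nat
    and \<Lambda> :: "'l set"
    and X :: "'l \<Rightarrow> 'a crystal"
    and R :: "'l \<Rightarrow> 'l \<Rightarrow> 'a \<times> 'a \<rightharpoonup> 'a \<times> 'a"
    and \<kappa> \<mu> :: 'l
    and E F :: "'a eps_system"
  assumes "n \<ge> 1"
    and "tropical_R_maps n \<Lambda> X R" and "\<kappa> \<in> \<Lambda>" and "\<mu> \<in> \<Lambda>"
    and "epsilon_system n (X \<kappa>) E" and "epsilon_system n (X \<mu>) F"
    and "\<And>i. i \<in> {1..n} \<Longrightarrow>
           nonzero_on_components (pts (X \<kappa>)) (epsi (X \<kappa>) i) \<and>
           nonzero_on_components (pts (X \<kappa>)) (gam (X \<kappa>) i) \<and>
           nonzero_on_components (pts (X \<mu>)) (epsi (X \<mu>) i) \<and>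
           nonzero_on_components (pts (X \<mu>)) (gam (X \<mu>) i)"
  shows "\<forall>J\<in>intervals n.
           rat_eq (pts (X \<kappa>) \<times>\<^sub>I pts (X \<mu>))
             (eps (eps_system_prod (X \<mu>) (X \<kappa>) F E) J \<circ>\<^sub>m R \<kappa> \<mu>)
             (eps (eps_system_prod (X \<kappa>) (X \<mu>) E F) J) \<and>
           rat_eq (pts (X \<kappa>) \<times>\<^sub>I pts (X \<mu>))
             (eps_star (eps_system_prod (X \<mu>) (X \<kappa>) F E) J \<circ>\<^sub>m R \<kappa> \<mu>)
             (eps_star (eps_system_prod (X \<kappa>) (X \<mu>) E F) J)"
proof -
  let ?X = "X \<kappa>" and ?Y = "X \<mu>"
  have cr: "geometric_crystal n ?X" "geometric_crystal n ?Y"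
    "geometric_crystal n (crystal_prod ?X ?Y)" "geometric_crystal n (crystal_prod ?Y ?X)"
    and bir: "birational_map (pts ?X \<times>\<^sub>I pts ?Y) (pts ?Y \<times>\<^sub>I pts ?X) (R \<kappa> \<mu>)"
    and R_act: "\<And>i. i \<in> {1..n} \<Longrightarrow> rat_eq (Gm_ind \<times>\<^sub>I pts ?X \<times>\<^sub>I pts ?Y)
          (\<lambda>(c, z). (act (crystal_prod ?Y ?X) i c \<circ>\<^sub>m R \<kappa> \<mu>) z)
          (\<lambda>(c, z). (R \<kappa> \<mu> \<circ>\<^sub>m act (crystal_prod ?X ?Y) i c) z)"
    and R_epsi: "\<And>i. i \<in> {1..n} \<Longrightarrow> rat_eq (pts ?X \<times>\<^sub>I pts ?Y)
          (epsi (crystal_prod ?X ?Y) i) (epsi (crystal_prod ?Y ?X) i \<circ>\<^sub>m R \<kappa> \<mu>)"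
    using assms(2-4) unfolding tropical_R_maps_def by blast+
  have ind: "ind_variety (pts ?X)" "ind_variety (pts ?Y)"
    using cr unfolding geometric_crystal_def by auto
  have regX: "\<forall>\<^sub>F x in generic (pts ?X). regular_point n ?X E x"
    by (rule eventually_regular_point[OF cr(1) assms(5)]) (use assms(7) in blast)
  have regY: "\<forall>\<^sub>F y in generic (pts ?Y). regular_point n ?Y F y"
    by (rule eventually_regular_point[OF cr(2) assms(6)]) (use assms(7) in blast)
  have both: "\<forall>\<^sub>F z in generic (pts ?X \<times>\<^sub>I pts ?Y). regular_point n ?X E (fst z) \<and> regular_point n ?Y F (snd z)"
    using eventually_generic_fst[OF ind regX] eventually_generic_snd[OF ind regY]
    by eventually_elim auto
  have "\<forall>\<^sub>F w in generic (pts ?Y \<times>\<^sub>I pts ?X). regular_point n ?Y F (fst w) \<and> regular_point n ?X E (snd w)"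
    using eventually_generic_fst[OF ind(2,1) regY] eventually_generic_snd[OF ind(2,1) regX]
    by eventually_elim auto
  from both eventually_generic_birational[OF bir this]
  have reg: "\<forall>\<^sub>F z in generic (pts ?X \<times>\<^sub>I pts ?Y). regular_point n ?X E (fst z) \<and> regular_point n ?Y F (snd z) \<and>
        (\<exists>w. R \<kappa> \<mu> z = Some w \<and> regular_point n ?Y F (fst w) \<and> regular_point n ?X E (snd w))"
    by eventually_elim auto
  show ?thesis
  proof
    fix J assume "J \<in> intervals n"
    then obtain s r where "J = {s..r}" "1 \<le> s" "s \<le> r" "r \<le> n" unfolding intervals_def by blast
    then have J: "J = {s..<Suc r}" and st: "1 \<le> s" "s < Suc r" "Suc r \<le> Suc n" by auto
    have "\<forall>\<^sub>F z in generic (pts ?X \<times>\<^sub>I pts ?Y). \<forall>w. R \<kappa> \<mu> z = Some w \<longrightarrow>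
        pval ?X ?Y E F z s (Suc r) = pval ?Y ?X F E w s (Suc r) \<and>
        pval_star ?X ?Y E F z s (Suc r) = pval_star ?Y ?X F E w s (Suc r)"
      using st by (intro eventually_pval_birational_eq[OF cr(1) assms(5) regX cr(2) assms(6) regY
            cr(3,4) bir R_act R_epsi reg]) auto
    with reg have "\<forall>\<^sub>F z in generic (pts ?X \<times>\<^sub>I pts ?Y).
        (\<exists>v. (eps (eps_system_prod ?Y ?X F E) J \<circ>\<^sub>m R \<kappa> \<mu>) z = Some v \<and>
             eps (eps_system_prod ?X ?Y E F) J z = Some v) \<and>
        (\<exists>v. (eps_star (eps_system_prod ?Y ?X F E) J \<circ>\<^sub>m R \<kappa> \<mu>) z = Some v \<and>
             eps_star (eps_system_prod ?X ?Y E F) J z = Some v)"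
    proof eventually_elim
      case (elim z)
      obtain w where w: "R \<kappa> \<mu> z = Some w" "regular_point n ?Y F (fst w)" "regular_point n ?X E (snd w)"
        using elim(1) by blast
      have z: "regular_point n ?X E (fst z)" "regular_point n ?Y F (snd z)" using elim(1) by auto
      show ?case
        using eps_system_prod_interval[OF z st] eps_system_prod_interval[OF w(2,3) st] elim(2) w(1)
        unfolding J by (simp del: One_nat_def)
    qed
    then show "rat_eq (pts ?X \<times>\<^sub>I pts ?Y)
             (eps (eps_system_prod ?Y ?X F E) J \<circ>\<^sub>m R \<kappa> \<mu>)
             (eps (eps_system_prod ?X ?Y E F) J) \<and>
           rat_eq (pts ?X \<times>\<^sub>I pts ?Y)
             (eps_star (eps_system_prod ?Y ?X F E) J \<circ>\<^sub>m R \<kappa> \<mu>)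
             (eps_star (eps_system_prod ?X ?Y E F) J)"
      unfolding rat_eq_iff_generic eventually_conj_iff .
  qed
qed

end
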